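(* Let $b\in(\sqrt[3]{6},\infty)$ and $a=-b$. Let $x_0\in C^{2+\beta}([-b,b])$ for some $\beta\in(0,1)$ satisfy $x_0(-b)=-1$, $x_0(b)=1$, $x_{0uu}(-b)=-b$, $x_{0uu}(b)=b$, $x_{0u}>0$ in $[-b,b]$, $x_0(u)=-x_0(-u)$ for all $u\in(-b,b)$, and $x_{0uu}(u)\le u$ for all $u\in(0,b)$. Let $x$ be the constructed solution (as defined in the context) of $$x_t=\frac{x_{uu}-u}{x_u^2}\ \text{ in }(-b,b)\times(0,\infty),\qquad x(-b,t)=-1,\ x(b,t)=1\ (t>0),\qquad x(\cdot,0)=x_0 .$$ Then there is $t_0>0$ such that $x_u>0$ in $[-b,b]\times(0,t_0)$, but $x(\cdot,t)$ has no differentiable inverse for any $t\ge t_0$. Moreover, for all sufficiently large $t$, the image of $[0,b]$ under $x(\cdot,t)$ contains negative elements.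
   Context: Subscripts $u,t$ denote (weak) partial derivatives. "$x(\cdot,t)$ has no differentiable inverse" means that $x(\cdot,t)$, defined on $[-b,b]$, is either not injective, or is injective but its inverse (defined on its image) is not everywhere differentiable. For $\varepsilon>0$ let $x_\varepsilon$ denote the unique classical solution in $C^{2,1}([-b,b]\times[0,\infty))\cap C^{4,2}([-b,b]\times(0,\infty))$ of the regularized problem $$x_{\varepsilon t}=\frac{x_{\varepsilon uu}-u}{x_{\varepsilon u}^2+\varepsilon}\ \text{ in }(-b,b)\times(0,\infty),\quad x_\varepsilon(-b,t)=-1,\ x_\varepsilon(b,t)=1\ (t>0),\quad x_\varepsilon(\cdot,0)=x_0 .$$ A constructed solution is a function $x$ for which there is a sequence $\varepsilon_k\searrow0$ such that, for every $p\in(1,\infty)$ and $\alpha\in(0,1)$: $x_{\varepsilon_k}\to x$ in $C^0_{loc}([0,\infty);C^{1+\alpha}([-b,b]))$, $x_{\varepsilon_k uu}\rightharpoonup x_{uu}$ weakly in $L^p((-b,b)\times(0,T))$ for every $T>0$, and $x_{\varepsilon_k t}\to x_t$ weak-$*$ in $L^\infty((-b,b)\times(0,\infty))$. Such an $x$ is a weak solution of the problem in the claim, in the sense that $\int_0^\infty\int_{-b}^b x_u^2x_t\varphi=-\int_0^\infty\int_{-b}^b x_u\varphi_u-\int_0^\infty\int_{-b}^b u\varphi$ for all $\varphi\in C_c^\infty((-b,b)\times(0,\infty))$, together with the boundary and initial conditions. *)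

theory Defs
  imports "HOL-Analysis.Analysis"
begin

(* One-sided derivatives at the endpoints; unique for b > 0. *)
definition ider :: "real \<Rightarrow> (real \<Rightarrow> real) \<Rightarrow> real \<Rightarrow> real" where
  "ider b f u = vector_derivative f (at u within {-b..b})"

definition pd_u :: "real \<Rightarrow> (real \<Rightarrow> real \<Rightarrow> real) \<Rightarrow> real \<Rightarrow> real \<Rightarrow> real" where
  "pd_u b f u t = ider b (\<lambda>v. f v t) u"

definition pd_t :: "(real \<Rightarrow> real \<Rightarrow> real) \<Rightarrow> real \<Rightarrow> real \<Rightarrow> real" where
  "pd_t f u t = vector_derivative (f u) (at t within {0..})"


subsection \<open>Hoelder spaces on a compact interval\<close>

definition holder_cont :: "real set \<Rightarrow> real \<Rightarrow> (real \<Rightarrow> real) \<Rightarrow> bool" where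
  "holder_cont S \<alpha> f \<longleftrightarrow> (\<exists>C. \<forall>u\<in>S. \<forall>v\<in>S. \<bar>f u - f v\<bar> \<le> C * \<bar>u - v\<bar> powr \<alpha>)"

(* The space of C^{k+alpha} functions on [-b,b], 0 < alpha < 1. *)
definition holder_space :: "real \<Rightarrow> nat \<Rightarrow> real \<Rightarrow> (real \<Rightarrow> real) set" where
  "holder_space b k \<alpha> =
     {f. (\<forall>i<k. (ider b ^^ i) f differentiable_on {-b..b}) \<and>
         holder_cont {-b..b} \<alpha> ((ider b ^^ k) f)}"

definition holder_norm :: "real \<Rightarrow> nat \<Rightarrow> real \<Rightarrow> (real \<Rightarrow> real) \<Rightarrow> real" where
  "holder_norm b k \<alpha> f =
     (\<Sum>i\<le>k. SUP u\<in>{-b..b}. \<bar>(ider b ^^ i) f u\<bar>) +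
     (SUP (u, v)\<in>{(u, v). u \<in> {-b..b} \<and> v \<in> {-b..b} \<and> u \<noteq> v}.
        \<bar>(ider b ^^ k) f u - (ider b ^^ k) f v\<bar> / \<bar>u - v\<bar> powr \<alpha>)"

(* C^0([0,infinity); C^{k+alpha}([-b,b])) *)
definition C0_holder :: "real \<Rightarrow> nat \<Rightarrow> real \<Rightarrow> (real \<Rightarrow> real \<Rightarrow> real) set" where
  "C0_holder b k \<alpha> =
     {f. (\<forall>t\<ge>0. (\<lambda>u. f u t) \<in> holder_space b k \<alpha>) \<and>
         (\<forall>t\<ge>0. ((\<lambda>s. holder_norm b k \<alpha> (\<lambda>u. f u s - f u t)) \<longlongrightarrow> 0) (at t within {0..}))}"

definition C0loc_holder_conv ::
  "real \<Rightarrow> nat \<Rightarrow> real \<Rightarrow> (nat \<Rightarrow> real \<Rightarrow> real \<Rightarrow> real) \<Rightarrow> (real \<Rightarrow> real \<Rightarrow> real) \<Rightarrow> bool" where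
  "C0loc_holder_conv b k \<alpha> X x \<longleftrightarrow>
     (\<forall>n. X n \<in> C0_holder b k \<alpha>) \<and> x \<in> C0_holder b k \<alpha> \<and>
     (\<forall>T>0. uniform_limit {0..T} (\<lambda>n t. holder_norm b k \<alpha> (\<lambda>u. X n u t - x u t)) (\<lambda>t. 0) sequentially)"


subsection \<open>Continuous partial derivatives\<close>

(* D i j plays the role of the partial derivative of order i in the first and order j in the second
   variable; P is the (downward closed) set of orders for which these exist and are continuous. *)
definition partials_on ::
  "(nat \<Rightarrow> nat \<Rightarrow> bool) \<Rightarrow> real set \<Rightarrow> real set \<Rightarrow> (nat \<Rightarrow> nat \<Rightarrow> real \<Rightarrow> real \<Rightarrow> real) \<Rightarrow> bool" where
  "partials_on P U I D \<longleftrightarrow>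
     (\<forall>i j. P i j \<longrightarrow> continuous_on (U \<times> I) (\<lambda>(u, t). D i j u t)) \<and>
     (\<forall>i j. P (Suc i) j \<longrightarrow> (\<forall>u\<in>U. \<forall>t\<in>I.
        ((\<lambda>v. D i j v t) has_real_derivative D (Suc i) j u t) (at u within U))) \<and>
     (\<forall>i j. P i (Suc j) \<longrightarrow> (\<forall>u\<in>U. \<forall>t\<in>I.
        ((\<lambda>s. D i j u s) has_real_derivative D i (Suc j) u t) (at t within I)))"

(* C^{2m,m}(U x I) *)
definition parabolic_C :: "nat \<Rightarrow> real set \<Rightarrow> real set \<Rightarrow> (real \<Rightarrow> real \<Rightarrow> real) set" where
  "parabolic_C m U I =
     {f. \<exists>D. (\<forall>u\<in>U. \<forall>t\<in>I. D 0 0 u t = f u t) \<and> partials_on (\<lambda>i j. i + 2 * j \<le> 2 * m) U I D}"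

definition test_fun :: "(real \<times> real) set \<Rightarrow> (real \<times> real \<Rightarrow> real) \<Rightarrow> bool" where
  "test_fun \<Omega> \<phi> \<longleftrightarrow>
     (\<exists>D. (\<forall>u t. D 0 0 u t = \<phi> (u, t)) \<and> partials_on (\<lambda>i j. True) UNIV UNIV D) \<and>
     compact (closure {z. \<phi> z \<noteq> 0}) \<and> closure {z. \<phi> z \<noteq> 0} \<subseteq> \<Omega>"


subsection \<open>Weak derivatives and weak convergence\<close>

definition locally_integrable :: "(real \<times> real) set \<Rightarrow> (real \<times> real \<Rightarrow> real) \<Rightarrow> bool" where
  "locally_integrable \<Omega> f \<longleftrightarrow> (\<forall>K. compact K \<and> K \<subseteq> \<Omega> \<longrightarrow> set_integrable lebesgue K f)"

definition weak_pd_u ::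
  "(real \<times> real) set \<Rightarrow> (real \<times> real \<Rightarrow> real) \<Rightarrow> (real \<times> real \<Rightarrow> real) \<Rightarrow> bool" where
  "weak_pd_u \<Omega> f g \<longleftrightarrow> locally_integrable \<Omega> f \<and> locally_integrable \<Omega> g \<and>
     (\<forall>\<phi>. test_fun \<Omega> \<phi> \<longrightarrow>
        (LINT (u, t)|lebesgue_on \<Omega>. f (u, t) * deriv (\<lambda>v. \<phi> (v, t)) u) =
        - (LINT z|lebesgue_on \<Omega>. g z * \<phi> z))"

definition weak_pd_t ::
  "(real \<times> real) set \<Rightarrow> (real \<times> real \<Rightarrow> real) \<Rightarrow> (real \<times> real \<Rightarrow> real) \<Rightarrow> bool" where
  "weak_pd_t \<Omega> f g \<longleftrightarrow> locally_integrable \<Omega> f \<and> locally_integrable \<Omega> g \<and>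
     (\<forall>\<phi>. test_fun \<Omega> \<phi> \<longrightarrow>
        (LINT (u, t)|lebesgue_on \<Omega>. f (u, t) * deriv (\<lambda>s. \<phi> (u, s)) t) =
        - (LINT z|lebesgue_on \<Omega>. g z * \<phi> z))"

definition Lp :: "'a measure \<Rightarrow> real \<Rightarrow> ('a \<Rightarrow> real) set" where
  "Lp M p = {f. f \<in> borel_measurable M \<and> integrable M (\<lambda>z. \<bar>f z\<bar> powr p)}"

definition Linf :: "'a measure \<Rightarrow> ('a \<Rightarrow> real) set" where
  "Linf M = {f. f \<in> borel_measurable M \<and> (\<exists>C. AE z in M. \<bar>f z\<bar> \<le> C)}"

(* For 1 < p the dual of L^p is L^q with the conjugate exponent q = p/(p-1). *)
definition weak_conv_Lp :: "'a measure \<Rightarrow> real \<Rightarrow> (nat \<Rightarrow> 'a \<Rightarrow> real) \<Rightarrow> ('a \<Rightarrow> real) \<Rightarrow> bool" where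
  "weak_conv_Lp M p F f \<longleftrightarrow> (\<forall>n. F n \<in> Lp M p) \<and> f \<in> Lp M p \<and>
     (\<forall>\<psi>\<in>Lp M (p / (p - 1)). (\<lambda>n. LINT z|M. F n z * \<psi> z) \<longlonglongrightarrow> (LINT z|M. f z * \<psi> z))"

definition weak_star_conv_Linf :: "'a measure \<Rightarrow> (nat \<Rightarrow> 'a \<Rightarrow> real) \<Rightarrow> ('a \<Rightarrow> real) \<Rightarrow> bool" where
  "weak_star_conv_Linf M F f \<longleftrightarrow> (\<forall>n. F n \<in> Linf M) \<and> f \<in> Linf M \<and>
     (\<forall>\<psi>\<in>Lp M 1. (\<lambda>n. LINT z|M. F n z * \<psi> z) \<longlonglongrightarrow> (LINT z|M. f z * \<psi> z))"


subsection \<open>Regularized problem and constructed solutions\<close>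

definition regularized_solution ::
  "real \<Rightarrow> (real \<Rightarrow> real) \<Rightarrow> real \<Rightarrow> (real \<Rightarrow> real \<Rightarrow> real) \<Rightarrow> bool" where
  "regularized_solution b x0 \<epsilon> y \<longleftrightarrow>
     y \<in> parabolic_C 1 {-b..b} {0..} \<inter> parabolic_C 2 {-b..b} {0<..} \<and>
     (\<forall>u\<in>{-b<..<b}. \<forall>t>0.
        pd_t y u t = (pd_u b (pd_u b y) u t - u) / ((pd_u b y u t)\<^sup>2 + \<epsilon>)) \<and>
     (\<forall>t>0. y (-b) t = -1 \<and> y b t = 1) \<and>
     (\<forall>u\<in>{-b..b}. y u 0 = x0 u)"

(* X k is the regularized solution for eps k, which is unique on [-b,b] x [0,infinity). *)
definition constructed_solution ::
  "real \<Rightarrow> (real \<Rightarrow> real) \<Rightarrow> (real \<Rightarrow> real \<Rightarrow> real) \<Rightarrow> bool" where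
  "constructed_solution b x0 x \<longleftrightarrow>
     (\<exists>(eps :: nat \<Rightarrow> real) X.
        (\<forall>k. eps k > 0) \<and> decseq eps \<and> eps \<longlonglongrightarrow> 0 \<and>
        (\<forall>k. regularized_solution b x0 (eps k) (X k)) \<and>
        (\<forall>\<alpha>\<in>{0<..<1}. C0loc_holder_conv b 1 \<alpha> X x) \<and>
        (\<exists>xuu. weak_pd_u ({-b<..<b} \<times> {0<..}) (\<lambda>(u, t). pd_u b x u t) xuu \<and>
           (\<forall>p>1. \<forall>T>0. weak_conv_Lp (lebesgue_on ({-b<..<b} \<times> {0<..<T})) p
              (\<lambda>k (u, t). pd_u b (pd_u b (X k)) u t) xuu)) \<and>
        (\<exists>xt. weak_pd_t ({-b<..<b} \<times> {0<..}) (\<lambda>(u, t). x u t) xt \<and>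
           weak_star_conv_Linf (lebesgue_on ({-b<..<b} \<times> {0<..}))
              (\<lambda>k (u, t). pd_t (X k) u t) xt))"

definition has_differentiable_inverse_on :: "real set \<Rightarrow> (real \<Rightarrow> real) \<Rightarrow> bool" where
  "has_differentiable_inverse_on S f \<longleftrightarrow>
     inj_on f S \<and> inv_into S f differentiable_on (f ` S)"

end

theory Submission
  imports Defs
begin

text \<open>
  The time derivative \<open>z\<close> of a regularized solution \<open>y\<close> solves a linear parabolic equation without
  zeroth-order term. As \<open>y\<close> is odd in \<open>u\<close>, the maximum principle on \<open>[0,b]\<close> gives \<open>-M \<le> z \<le> 0\<close> with
  \<open>M\<close> independent of \<open>\<epsilon>\<close>. Hence the slope \<open>y\<^sub>u(0,t)\<close> is nonincreasing in \<open>t\<close>, \<open>y\<^sub>u\<close> is bounded, and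
  \<open>y\<^sub>u\<^sub>u \<ge> u - M (y\<^sub>u\<^sup>2 + \<epsilon>)\<close>. In the limit \<open>\<epsilon> \<rightarrow> 0\<close> the last inequality forbids \<open>x\<^sub>u\<close> to vanish first at
  some \<open>u > 0\<close>: positivity of \<open>x\<^sub>u\<close> can only be lost at \<open>u = 0\<close>, and there it is lost forever.
  It is lost because testing the equation with \<open>u - b\<close> on \<open>[0,b]\<close> and averaging over \<open>[0,T]\<close> yields
  \<open>b x\<^sub>u(0,T) \<le> 1 - b\<^sup>3/6 + C/T\<close>, which is negative for large \<open>T\<close>.
\<close>

section \<open>Derivatives and the maximum principle\<close>

text \<open>The second point \<open>y\<close> makes \<open>x\<close> a limit point of the connected
  set, so a one-sided derivative at an endpoint is as unique as an interior one.\<close>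

lemma vector_derivative_connected:
  fixes f :: "real \<Rightarrow> real"
  assumes "(f has_real_derivative D) (at x within S)" "connected S" "x \<in> S" "y \<in> S" "y \<noteq> x"
  shows "vector_derivative f (at x within S) = D"
proof (rule vector_derivative_within)
  have "x islimpt S"
    using connected_imp_perfect[of S x] assms by blast
  then show "at x within S \<noteq> bot"
    by (simp add: trivial_limit_within)
  show "(f has_vector_derivative D) (at x within S)"
    using assms(1) by (simp add: has_real_derivative_iff_has_vector_derivative)
qed

lemma ider_eq:
  assumes "0 < b" "u \<in> {-b..b}" "(f has_real_derivative D) (at u within {-b..b})"
  shows "ider b f u = D"
proof -
  have "\<exists>v\<in>{-b..b}. v \<noteq> u"
    using assms(1) by (intro bexI[of _ "if u = b then -b else b"]) auto
  then show ?thesis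
    unfolding ider_def using vector_derivative_connected[OF assms(3)] assms(2) connected_Icc[of "-b" b] by blast
qed

lemma pd_t_eq:
  assumes "0 \<le> t" "(f u has_real_derivative D) (at t within {0..})"
  shows "pd_t f u t = D"
  unfolding pd_t_def
  by (rule vector_derivative_connected[OF assms(2), of "t + 1"]) (use assms in auto)

lemma DERIV_within_unique:
  fixes f :: "real \<Rightarrow> real"
  assumes "(f has_real_derivative D) (at x within S)" "(f has_real_derivative E) (at x within S)"
    and "connected S" "x \<in> S" "y \<in> S" "y \<noteq> x"
  shows "D = E"
  using vector_derivative_connected assms by metis

text \<open>If \<open>D\<close> were positive, \<open>f'\<close> would be positive just to the right
  of \<open>u\<close>, and by the mean value theorem \<open>f\<close> would exceed
  \<open>f u\<close> there.\<close>

lemma DERIV_local_max_second_nonpos: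
  fixes f f' :: "real \<Rightarrow> real"
  assumes "0 < r" and f: "\<And>v. \<bar>v - u\<bar> < r \<Longrightarrow> (f has_real_derivative f' v) (at v)"
    and f': "(f' has_real_derivative D) (at u)"
    and max: "\<And>v. \<bar>v - u\<bar> < r \<Longrightarrow> f v \<le> f u"
  shows "f' u = 0" "D \<le> 0"
proof -
  show f'u: "f' u = 0"
    by (rule DERIV_local_max[OF f[of u] \<open>0 < r\<close>]) (use assms(1) max in \<open>auto simp: abs_minus_commute\<close>)
  show "D \<le> 0"
  proof (rule ccontr)
    assume "\<not> D \<le> 0"
    then obtain d where d: "0 < d" "\<And>h. 0 < h \<Longrightarrow> h < d \<Longrightarrow> f' u < f' (u + h)"
      using DERIV_pos_inc_right[OF f'] by force
    define h where "h = min d r / 2"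
    have h: "0 < h" "h < d" "h < r" using d(1) assms(1) by (auto simp: h_def min_def)
    obtain v where v: "u < v" "v < u + h" "f (u + h) - f u = (u + h - u) * f' v"
      using MVT2[of u "u + h" f f'] h f by (auto simp: abs_if)
    have "0 < f' v" using d(2)[of "v - u"] v h f'u by simp
    then have "0 < h * f' v" using h by simp
    then have "f u < f (u + h)" using v by simp
    with max[of "u + h"] h show False by simp
  qed
qed

text \<open>There is no zeroth-order term, so the coefficient \<open>B\<close> may be unbounded as \<open>t\<close> tends to \<open>0\<close>.\<close>

lemma parabolic_maximum_principle:
  fixes f fu fuu ft A B :: "real \<Rightarrow> real \<Rightarrow> real"
  assumes cont: "continuous_on ({c..d} \<times> {0..T}) (\<lambda>(u, t). f u t)"
    and fu: "\<And>u t. u \<in> {c<..<d} \<Longrightarrow> t \<in> {0<..T} \<Longrightarrow> ((\<lambda>v. f v t) has_real_derivative fu u t) (at u)"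
    and fuu: "\<And>u t. u \<in> {c<..<d} \<Longrightarrow> t \<in> {0<..T} \<Longrightarrow> ((\<lambda>v. fu v t) has_real_derivative fuu u t) (at u)"
    and ft: "\<And>u t. u \<in> {c<..<d} \<Longrightarrow> t \<in> {0<..T} \<Longrightarrow> ((\<lambda>s. f u s) has_real_derivative ft u t) (at t)"
    and eq: "\<And>u t. u \<in> {c<..<d} \<Longrightarrow> t \<in> {0<..T} \<Longrightarrow> ft u t = A u t * fuu u t + B u t * fu u t"
    and A: "\<And>u t. u \<in> {c<..<d} \<Longrightarrow> t \<in> {0<..T} \<Longrightarrow> 0 \<le> A u t"
    and init: "\<And>u. u \<in> {c..d} \<Longrightarrow> f u 0 \<le> K"
    and left: "\<And>t. t \<in> {0..T} \<Longrightarrow> f c t \<le> K"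
    and right: "\<And>t. t \<in> {0..T} \<Longrightarrow> f d t \<le> K"
    and u1: "u1 \<in> {c..d}" and t1: "t1 \<in> {0..T}"
  shows "f u1 t1 \<le> K"
proof (rule ccontr)
  assume "\<not> f u1 t1 \<le> K"
  \<comment> \<open>Tilting by \<open>- \<delta> * t\<close> makes the inequality at a maximum
    strict; \<open>\<delta>\<close> is small enough that the tilted value at \<open>(u1, t1)\<close>
    still exceeds \<open>K\<close>.\<close>
  define \<delta> where "\<delta> = (f u1 t1 - K) / (2 * (T + 1))"
  have \<delta>: "0 < \<delta>" using \<open>\<not> f u1 t1 \<le> K\<close> t1 by (auto simp: \<delta>_def)
  have "\<delta> * t1 \<le> \<delta> * (T + 1)" using \<delta> t1 by (intro mult_left_mono) auto
  also have "\<dots> = (f u1 t1 - K) / 2" using t1 by (auto simp: \<delta>_def field_simps)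
  also have "\<dots> < f u1 t1 - K" using \<open>\<not> f u1 t1 \<le> K\<close> by simp
  finally have big: "K < f u1 t1 - \<delta> * t1" by simp
  define g where "g = (\<lambda>(u, t). f u t - \<delta> * t)"
  have "continuous_on ({c..d} \<times> {0..T}) g"
    unfolding g_def case_prod_unfold
    by (intro continuous_intros cont[unfolded case_prod_unfold])
  moreover have "compact ({c..d} \<times> {0..T})" "{c..d} \<times> {0..T} \<noteq> {}"
    using u1 t1 by (auto intro!: compact_Times)
  ultimately obtain p where "p \<in> {c..d} \<times> {0..T}" "\<forall>q\<in>{c..d} \<times> {0..T}. g q \<le> g p"
    using continuous_attains_sup by blast
  then obtain u t where ut: "u \<in> {c..d}" "t \<in> {0..T}"
    and max: "\<And>v s. v \<in> {c..d} \<Longrightarrow> s \<in> {0..T} \<Longrightarrow> f v s - \<delta> * s \<le> f u t - \<delta> * t"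
    unfolding g_def by (cases p) auto
  have "K < f u t - \<delta> * t" using big max[OF u1 t1] by linarith
  moreover have "0 \<le> \<delta> * t" using \<delta> ut by simp
  ultimately have K: "K < f u t" by linarith
  have "t \<noteq> 0" "u \<noteq> c" "u \<noteq> d" using K init left right ut by force+
  then have t: "t \<in> {0<..T}" and u: "u \<in> {c<..<d}" using ut by auto
  define r where "r = min (u - c) (d - u)"
  have r: "0 < r" "\<And>v. \<bar>v - u\<bar> < r \<Longrightarrow> v \<in> {c<..<d}" using u by (auto simp: r_def)
  have loc: "\<And>v. \<bar>v - u\<bar> < r \<Longrightarrow> f v t \<le> f u t"
    using max[of _ t] ut(2) r(2) by force
  note second = DERIV_local_max_second_nonpos[of r u "\<lambda>v. f v t" "\<lambda>v. fu v t", OF r(1) fu[OF r(2) t] fuu[OF u t] loc]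
  have "ft u t \<le> 0"
    using eq[OF u t] second A[OF u t] by (simp add: mult_nonneg_nonpos)
  then have neg: "ft u t - \<delta> < 0" using \<delta> by simp
  have "((\<lambda>s. f u s - \<delta> * s) has_real_derivative ft u t - \<delta>) (at t)"
    using ft[OF u t] by (auto intro!: derivative_eq_intros)
  \<comment> \<open>Since \<open>t\<close> may equal \<open>T\<close>, the maximum is contradicted
    by looking backwards in time only.\<close>
  from DERIV_neg_dec_left[OF this neg] obtain e where
    e: "0 < e" "\<And>h. 0 < h \<Longrightarrow> h < e \<Longrightarrow> f u t - \<delta> * t < f u (t - h) - \<delta> * (t - h)" by blast
  define h where "h = min e t / 2"
  have "0 < h" "h < e" "h < t" using e(1) t by (auto simp: h_def min_def)
  with e(2)[of h] max[OF ut(1), of "t - h"] t show False by auto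
qed

section \<open>The regularized flow\<close>

text \<open>Here \<open>w = y\<^sub>u\<close>, \<open>q = y\<^sub>u\<^sub>u\<close>, \<open>z = y\<^sub>t\<close>. The constant \<open>M\<close> does not involve \<open>\<epsilon>\<close>.\<close>

locale regularized_flow =
  fixes b \<epsilon> M :: real and y w q z zu zuu zt :: "real \<Rightarrow> real \<Rightarrow> real"
  assumes b_pos: "0 < b" and eps_pos: "0 < \<epsilon>" and M_nonneg: "0 \<le> M"
    and y_u: "\<And>u t. u \<in> {-b..b} \<Longrightarrow> 0 \<le> t \<Longrightarrow> ((\<lambda>v. y v t) has_real_derivative w u t) (at u within {-b..b})"
    and w_u: "\<And>u t. u \<in> {-b..b} \<Longrightarrow> 0 \<le> t \<Longrightarrow> ((\<lambda>v. w v t) has_real_derivative q u t) (at u within {-b..b})"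
    and y_t: "\<And>u t. u \<in> {-b..b} \<Longrightarrow> 0 \<le> t \<Longrightarrow> ((\<lambda>s. y u s) has_real_derivative z u t) (at t within {0..})"
    and cont_y: "continuous_on ({-b..b} \<times> {0..}) (\<lambda>(u, t). y u t)"
    and cont_w: "continuous_on ({-b..b} \<times> {0..}) (\<lambda>(u, t). w u t)"
    and cont_q: "continuous_on ({-b..b} \<times> {0..}) (\<lambda>(u, t). q u t)"
    and cont_z: "continuous_on ({-b..b} \<times> {0..}) (\<lambda>(u, t). z u t)"
    and z_u: "\<And>u t. u \<in> {-b..b} \<Longrightarrow> 0 < t \<Longrightarrow> ((\<lambda>v. z v t) has_real_derivative zu u t) (at u within {-b..b})"
    and zu_u: "\<And>u t. u \<in> {-b..b} \<Longrightarrow> 0 < t \<Longrightarrow> ((\<lambda>v. zu v t) has_real_derivative zuu u t) (at u within {-b..b})"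
    and w_t: "\<And>u t. u \<in> {-b..b} \<Longrightarrow> 0 < t \<Longrightarrow> ((\<lambda>s. w u s) has_real_derivative zu u t) (at t)"
    and q_t: "\<And>u t. u \<in> {-b..b} \<Longrightarrow> 0 < t \<Longrightarrow> ((\<lambda>s. q u s) has_real_derivative zuu u t) (at t)"
    and z_t: "\<And>u t. u \<in> {-b..b} \<Longrightarrow> 0 < t \<Longrightarrow> ((\<lambda>s. z u s) has_real_derivative zt u t) (at t)"
    and flow: "\<And>u t. u \<in> {-b<..<b} \<Longrightarrow> 0 < t \<Longrightarrow> z u t * ((w u t)\<^sup>2 + \<epsilon>) = q u t - u"
    and bdry: "\<And>t. 0 \<le> t \<Longrightarrow> y b t = 1" "\<And>t. 0 \<le> t \<Longrightarrow> y (-b) t = -1"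
    and init_odd: "\<And>u. u \<in> {-b..b} \<Longrightarrow> y (-u) 0 = - y u 0"
    and init_w: "\<And>u. u \<in> {-b..b} \<Longrightarrow> 0 < w u 0"
    and init_q: "\<And>u. u \<in> {0<..<b} \<Longrightarrow> q u 0 \<le> u"
    and init_M: "\<And>u. u \<in> {0..b} \<Longrightarrow> - M * (w u 0)\<^sup>2 \<le> q u 0 - u"
begin

section \<open>The equation on the closed domain and its time derivative\<close>

lemma at_interior: "u \<in> {-b<..<b} \<Longrightarrow> at u within {-b..b} = at u"
  by (simp add: at_within_Icc_at)

lemma at_positive: "(0::real) < t \<Longrightarrow> at t within {0..} = at t"
  by (rule at_within_interior) simp

text \<open>The open domain is dense in the closed one and all terms are continuous up to
  \<open>t = 0\<close>. In particular this yields \<open>z\<close> at time 0 from the initial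
  data.\<close>

lemma flow_closed:
  assumes "u \<in> {-b..b}" "0 \<le> t"
  shows "z u t * ((w u t)\<^sup>2 + \<epsilon>) = q u t - u"
proof -
  define h where "h = (\<lambda>(u, t). z u t * ((w u t)\<^sup>2 + \<epsilon>) - q u t + u)"
  have cl: "closure ({-b<..<b} \<times> {0<..}) = {-b..b} \<times> {0::real..}"
    using b_pos by (simp add: closure_Times)
  have "continuous_on ({-b..b} \<times> {0..}) h"
    unfolding h_def case_prod_unfold
    by (intro continuous_intros cont_z[unfolded case_prod_unfold] cont_w[unfolded case_prod_unfold]
        cont_q[unfolded case_prod_unfold])
  then have "h (u, t) = 0"
    using continuous_constant_on_closure[of "{-b<..<b} \<times> {0<..}" h 0 "(u, t)"] assms flow
    unfolding cl by (auto simp: h_def)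
  then show ?thesis by (simp add: h_def)
qed

lemma denom_pos: "0 < (w u t)\<^sup>2 + \<epsilon>"
  using eps_pos by (simp add: add_nonneg_pos)

text \<open>Differentiate \<open>z * (w\<^sup>2 + \<epsilon>) = q - u\<close> in time: by
  \<open>w_t\<close> and \<open>q_t\<close> the derivatives of \<open>w\<close> and \<open>q\<close>
  are \<open>zu\<close> and \<open>zuu\<close>, so undifferentiated \<open>z\<close> enters only
  through the coefficient of \<open>zu\<close>.\<close>

lemma z_linear_eq:
  assumes "u \<in> {-b<..<b}" "0 < t"
  shows "zt u t = 1 / ((w u t)\<^sup>2 + \<epsilon>) * zuu u t + (- 2 * w u t * z u t / ((w u t)\<^sup>2 + \<epsilon>)) * zu u t"
proof -
  have u: "u \<in> {-b..b}" using assms by auto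
  have "((\<lambda>s. z u s * ((w u s)\<^sup>2 + \<epsilon>)) has_real_derivative
          zt u t * ((w u t)\<^sup>2 + \<epsilon>) + z u t * (2 * w u t * zu u t)) (at t)"
    by (rule derivative_eq_intros z_t[OF u] w_t[OF u] assms refl)+ (simp add: algebra_simps)
  moreover have "((\<lambda>s. z u s * ((w u s)\<^sup>2 + \<epsilon>)) has_real_derivative zuu u t) (at t)"
  proof (rule has_field_derivative_transform_within_open[of "\<lambda>s. q u s - u" _ _ "{0<..}"])
    show "((\<lambda>s. q u s - u) has_real_derivative zuu u t) (at t)"
      using q_t[OF u assms(2)] by (auto intro!: derivative_eq_intros)
  qed (use assms flow in auto)
  ultimately have "zt u t * ((w u t)\<^sup>2 + \<epsilon>) + z u t * (2 * w u t * zu u t) = zuu u t"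
    by (rule DERIV_unique)
  then have "zt u t = (zuu u t - 2 * w u t * z u t * zu u t) / ((w u t)\<^sup>2 + \<epsilon>)"
    using denom_pos[of u t] by (simp add: eq_divide_eq algebra_simps)
  then show ?thesis by (simp add: diff_divide_distrib)
qed

section \<open>Oddness in the space variable\<close>

lemma continuous_on_reflect:
  assumes "continuous_on ({-b..b} \<times> {0..}) (\<lambda>(u, t). f u t)"
  shows "continuous_on ({-b..b} \<times> {0::real..}) (\<lambda>(u, t). f (-u) t :: real)"
proof -
  have "continuous_on ({-b..b} \<times> {0..}) ((\<lambda>(u, t). f u t) \<circ> (\<lambda>p. (- fst p, snd p)))"
  proof (rule continuous_on_compose)
    show "continuous_on ({-b..b} \<times> {0..}) (\<lambda>p. (- fst p, snd p))"
      by (intro continuous_intros)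
    have "(\<lambda>p. (- fst p, snd p)) ` ({-b..b} \<times> {0..}) \<subseteq> {-b..b} \<times> {0..}" by auto
    then show "continuous_on ((\<lambda>p. (- fst p, snd p)) ` ({-b..b} \<times> {0..})) (\<lambda>(u, t). f u t)"
      by (rule continuous_on_subset[OF assms])
  qed
  then show ?thesis by (simp add: o_def case_prod_unfold)
qed

text \<open>The sum \<open>y u t + y (-u) t\<close> solves a linear equation of its own.\<close>

lemma y_odd:
  assumes "u \<in> {-b..b}" "0 \<le> t"
  shows "y (-u) t = - y u t"
proof -
  \<comment> \<open>The maximum principle for both signs \<open>\<sigma>\<close> bounds the sum from
    above and from below by 0.\<close>
  have bound: "\<sigma> * (y u t + y (-u) t) \<le> 0" if "\<sigma> = 1 \<or> \<sigma> = -1" for \<sigma> :: real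
  proof (rule parabolic_maximum_principle[where c = "-b" and d = b and T = t
        and f = "\<lambda>u t. \<sigma> * (y u t + y (-u) t)"
        and fu = "\<lambda>u t. \<sigma> * (w u t - w (-u) t)" and fuu = "\<lambda>u t. \<sigma> * (q u t + q (-u) t)"
        and ft = "\<lambda>u t. \<sigma> * (z u t + z (-u) t)"
        and A = "\<lambda>u t. 1 / ((w u t)\<^sup>2 + \<epsilon>)"
        and B = "\<lambda>u t. z (-u) t * (w u t + w (-u) t) / ((w u t)\<^sup>2 + \<epsilon>)"])
    show "continuous_on ({-b..b} \<times> {0..t}) (\<lambda>(u, t). \<sigma> * (y u t + y (-u) t))"
      by (rule continuous_on_subset[where s = "{-b..b} \<times> {0..}"], unfold case_prod_unfold)
        (intro continuous_intros cont_y[unfolded case_prod_unfold]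
          continuous_on_reflect[OF cont_y, unfolded case_prod_unfold], auto)
  next
    fix v s assume v: "v \<in> {-b<..<b}" and s: "s \<in> {0<..t}"
    then have v': "v \<in> {-b..b}" "-v \<in> {-b..b}" "-v \<in> {-b<..<b}" by auto
    have "((\<lambda>v. y v s) has_real_derivative w v s) (at v)"
      and y': "((\<lambda>v. y v s) has_real_derivative w (-v) s) (at (-v))"
      and "((\<lambda>v. w v s) has_real_derivative q v s) (at v)"
      and w': "((\<lambda>v. w v s) has_real_derivative q (-v) s) (at (-v))"
      using y_u[of v s] y_u[of "-v" s] w_u[of v s] w_u[of "-v" s] v v' s
      by (auto simp: at_interior)
    then show "((\<lambda>v. \<sigma> * (y v s + y (-v) s)) has_real_derivative \<sigma> * (w v s - w (-v) s)) (at v)"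
      and "((\<lambda>v. \<sigma> * (w v s - w (-v) s)) has_real_derivative \<sigma> * (q v s + q (-v) s)) (at v)"
      using y'[unfolded DERIV_mirror] w'[unfolded DERIV_mirror] by (auto intro!: derivative_eq_intros simp: algebra_simps)
    show "((\<lambda>s. \<sigma> * (y v s + y (-v) s)) has_real_derivative \<sigma> * (z v s + z (-v) s)) (at s)"
      using y_t[of v s] y_t[of "-v" s] v' s by (auto intro!: derivative_eq_intros simp: at_positive)
    have "z v s * ((w v s)\<^sup>2 + \<epsilon>) = q v s - v" "z (-v) s * ((w (-v) s)\<^sup>2 + \<epsilon>) = q (-v) s + v"
      using flow[OF v, of s] flow[OF v'(3), of s] s by auto
    \<comment> \<open>Adding the equations at \<open>v\<close> and \<open>-v\<close> cancels the
      source \<open>v\<close>. The mismatch of the denominators factors through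
      \<open>w v s - w (-v) s\<close>, the \<open>u\<close>-derivative of the sum, and this yields
      the drift \<open>B\<close>.\<close>
    then have "(z v s + z (-v) s) * ((w v s)\<^sup>2 + \<epsilon>) =
      q v s + q (-v) s + z (-v) s * (w v s + w (-v) s) * (w v s - w (-v) s)"
      by algebra
    then have e: "z v s + z (-v) s = (q v s + q (-v) s + z (-v) s * (w v s + w (-v) s) * (w v s - w (-v) s)) / ((w v s)\<^sup>2 + \<epsilon>)"
      using denom_pos[of v s] by (simp add: eq_divide_eq)
    show "\<sigma> * (z v s + z (-v) s) = 1 / ((w v s)\<^sup>2 + \<epsilon>) * (\<sigma> * (q v s + q (-v) s)) +
       z (-v) s * (w v s + w (-v) s) / ((w v s)\<^sup>2 + \<epsilon>) * (\<sigma> * (w v s - w (-v) s))"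
      by (subst e) (simp add: add_divide_distrib diff_divide_distrib algebra_simps)
    show "0 \<le> 1 / ((w v s)\<^sup>2 + \<epsilon>)" using denom_pos[of v s] by simp
  qed (use assms init_odd bdry in auto)
  show ?thesis using bound[of 1] bound[of "-1"] by simp
qed

lemma y_0: "0 \<le> t \<Longrightarrow> y 0 t = 0"
  using y_odd[of 0 t] b_pos by simp

section \<open>Two-sided bounds on the time derivative\<close>

lemma z_bdry:
  assumes "0 \<le> t"
  shows "z 0 t = 0" "z b t = 0"
proof -
  have "z u t = 0" if "u \<in> {-b..b}" "\<And>s. 0 \<le> s \<Longrightarrow> y u s = C" for u C
  proof (rule DERIV_within_unique[OF y_t[OF that(1) assms], of _ "t + 1"])
    show "(y u has_real_derivative 0) (at t within {0..})"
      by (rule has_field_derivative_transform_within[of "\<lambda>_. C" _ _ _ 1])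
        (use assms that(2) in auto)
  qed (use assms in auto)
  from this[of 0 0] this[of b 1] show "z 0 t = 0" "z b t = 0"
    using b_pos y_0 bdry by auto
qed

text \<open>The sign \<open>\<sigma>\<close> treats maximum and minimum at once. On the sides
  \<open>z\<close> vanishes, at \<open>b\<close> by the boundary condition and at \<open>0\<close>
  by oddness, so with \<open>0 \<le> K\<close> only the initial values matter.\<close>

lemma z_extremum:
  assumes "\<sigma> = 1 \<or> \<sigma> = (-1::real)" "0 \<le> K" "\<And>u. u \<in> {0..b} \<Longrightarrow> \<sigma> * z u 0 \<le> K"
    and "u \<in> {0..b}" "0 \<le> t"
  shows "\<sigma> * z u t \<le> K"
proof (rule parabolic_maximum_principle[where c = 0 and d = b and T = t and f = "\<lambda>u t. \<sigma> * z u t"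
      and fu = "\<lambda>u t. \<sigma> * zu u t" and fuu = "\<lambda>u t. \<sigma> * zuu u t" and ft = "\<lambda>u t. \<sigma> * zt u t"
      and A = "\<lambda>u t. 1 / ((w u t)\<^sup>2 + \<epsilon>)"
      and B = "\<lambda>u t. - 2 * w u t * z u t / ((w u t)\<^sup>2 + \<epsilon>)"])
  show "continuous_on ({0..b} \<times> {0..t}) (\<lambda>(u, t). \<sigma> * z u t)"
    by (rule continuous_on_subset[where s = "{-b..b} \<times> {0..}"], unfold case_prod_unfold)
      (intro continuous_intros cont_z[unfolded case_prod_unfold], use b_pos in auto)
next
  fix v s assume "v \<in> {0<..<b}" and s: "s \<in> {0<..t}"
  then have v: "v \<in> {-b<..<b}" "v \<in> {-b..b}" by auto
  show "((\<lambda>v. \<sigma> * z v s) has_real_derivative \<sigma> * zu v s) (at v)"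
    and "((\<lambda>v. \<sigma> * zu v s) has_real_derivative \<sigma> * zuu v s) (at v)"
    and "((\<lambda>s. \<sigma> * z v s) has_real_derivative \<sigma> * zt v s) (at s)"
    using z_u[of v s] zu_u[of v s] z_t[of v s] v s
    by (auto simp: at_interior intro!: DERIV_cmult)
  show "\<sigma> * zt v s = 1 / ((w v s)\<^sup>2 + \<epsilon>) * (\<sigma> * zuu v s) +
      (- 2 * w v s * z v s / ((w v s)\<^sup>2 + \<epsilon>)) * (\<sigma> * zu v s)"
    using s by (subst z_linear_eq[OF v(1)]) (auto simp: algebra_simps)
  show "0 \<le> 1 / ((w v s)\<^sup>2 + \<epsilon>)" using denom_pos[of v s] by simp
qed (use assms z_bdry in auto)

lemma z_nonpos:
  assumes "u \<in> {0..b}" "0 \<le> t"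
  shows "z u t \<le> 0"
proof -
  have "z v 0 \<le> 0" if "v \<in> {0..b}" for v
  \<comment> \<open>\<open>init_q\<close> speaks of the open interval; at its ends \<open>z\<close>
    vanishes.\<close>
  proof (cases "v = 0 \<or> v = b")
    case True
    then show ?thesis using z_bdry[of 0] by auto
  next
    case False
    then have "z v 0 * ((w v 0)\<^sup>2 + \<epsilon>) \<le> 0"
      using flow_closed[of v 0] init_q[of v] that by auto
    then show ?thesis using denom_pos[of v 0] by (simp add: mult_le_0_iff)
  qed
  then show ?thesis using z_extremum[of 1 0 u t] assms by simp
qed

text \<open>Since \<open>M\<close> is nonnegative, adding \<open>\<epsilon>\<close> to the squared
  slope only weakens \<open>init_M\<close>, so the same \<open>M\<close> serves every
  \<open>\<epsilon>\<close>.\<close>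

lemma z_lower:
  assumes "u \<in> {0..b}" "0 \<le> t"
  shows "- M \<le> z u t"
proof -
  have "- z v 0 \<le> M" if "v \<in> {0..b}" for v
  proof -
    have "- M * ((w v 0)\<^sup>2 + \<epsilon>) \<le> - M * (w v 0)\<^sup>2"
      using M_nonneg eps_pos by (simp add: algebra_simps)
    also have "\<dots> \<le> z v 0 * ((w v 0)\<^sup>2 + \<epsilon>)"
      using flow_closed[of v 0] init_M[of v] that by auto
    finally have "- M \<le> z v 0" by (simp only: mult_le_cancel_right_pos[OF denom_pos])
    then show ?thesis by simp
  qed
  then show ?thesis using z_extremum[of "-1" M u t] assms M_nonneg by simp
qed

section \<open>Monotonicity in time and bounds on the slope\<close>

lemma y_antimono:
  assumes "u \<in> {0..b}" "0 \<le> s" "s \<le> t"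
  shows "y u t \<le> y u s"
proof (rule DERIV_nonpos_imp_decreasing_open[OF assms(3)])
  fix r assume r: "s < r" "r < t"
  then show "\<exists>D. ((y u) has_real_derivative D) (at r) \<and> D \<le> 0"
    using y_t[of u r] z_nonpos[of u r] assms at_positive[of r] by auto
next
  have "continuous_on {0..} (y u)"
    by (rule DERIV_continuous_on) (use y_t[of u] assms in auto)
  then show "continuous_on {s..t} (y u)"
    by (rule continuous_on_subset) (use assms in auto)
qed

text \<open>At the origin \<open>y\<close> stays 0 while to its right \<open>y\<close> decreases in
  time, so the difference quotients at the origin decrease.\<close>

lemma w_0_antimono:
  assumes "0 \<le> s" "s \<le> t"
  shows "w 0 t \<le> w 0 s"
proof (rule ccontr)
  assume "\<not> w 0 t \<le> w 0 s"
  then have pos: "0 < w 0 t - w 0 s" by simp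
  have "((\<lambda>v. y v t - y v s) has_real_derivative w 0 t - w 0 s) (at 0 within {-b..b})"
    using y_u assms b_pos by (intro DERIV_diff) auto
  from has_real_derivative_pos_inc_right[OF this pos]
  obtain d where d: "0 < d" "\<And>h. 0 < h \<Longrightarrow> h \<in> {-b..b} \<Longrightarrow> h < d \<Longrightarrow> y 0 t - y 0 s < y h t - y h s"
    by auto
  define h where "h = min d b / 2"
  have "0 < h" "h < d" "h < b" using d(1) b_pos by (auto simp: h_def min_def)
  then show False using d(2)[of h] y_antimono[of h s t] assms y_0 by auto
qed

text \<open>At \<open>b\<close> the value is pinned to 1 while \<open>y\<close> decreases to the
  left of it, so the slope at \<open>b\<close> cannot fall below its positive initial value.\<close>

lemma w_b_nonneg:
  assumes "0 \<le> t"
  shows "0 \<le> w b t"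
proof (rule ccontr)
  assume "\<not> 0 \<le> w b t"
  then have neg: "w b t - w b 0 < 0" using init_w[of b] b_pos by auto
  have "((\<lambda>v. y v t - y v 0) has_real_derivative w b t - w b 0) (at b within {-b..b})"
    using y_u assms b_pos by (intro DERIV_diff) auto
  from has_real_derivative_neg_dec_left[OF this neg]
  obtain d where d: "0 < d" "\<And>h. 0 < h \<Longrightarrow> b - h \<in> {-b..b} \<Longrightarrow> h < d \<Longrightarrow> y b t - y b 0 < y (b - h) t - y (b - h) 0"
    by auto
  define h where "h = min d b / 2"
  have "0 < h" "h < d" "h < b" using d(1) b_pos by (auto simp: h_def min_def)
  then show False using d(2)[of h] y_antimono[of "b - h" 0 t] assms bdry by auto
qed

text \<open>The derivative of \<open>w - u\<^sup>2 / 2\<close> is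
  \<open>q - u = z * (w\<^sup>2 + \<epsilon>)\<close>, and \<open>z \<le> 0\<close>.\<close>

lemma w_minus_square_antimono:
  assumes "0 \<le> v" "v \<le> u" "u \<le> b" "0 \<le> t"
  shows "w u t - u\<^sup>2 / 2 \<le> w v t - v\<^sup>2 / 2"
proof (rule DERIV_nonpos_imp_decreasing_open[OF assms(2), of "\<lambda>r. w r t - r\<^sup>2 / 2"])
  fix r assume r: "v < r" "r < u"
  then have r': "r \<in> {-b<..<b}" "r \<in> {-b..b}" "r \<in> {0..b}" using assms by auto
  have "((\<lambda>r. w r t) has_real_derivative q r t) (at r)"
    using w_u[OF r'(2) assms(4)] at_interior[OF r'(1)] by simp
  then have "((\<lambda>r. w r t - r\<^sup>2 / 2) has_real_derivative q r t - r) (at r)"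
    by (auto intro!: derivative_eq_intros)
  moreover have "q r t - r \<le> 0"
    using flow_closed[OF r'(2) assms(4)] z_nonpos[OF r'(3) assms(4)] denom_pos[of r t]
    by (metis less_imp_le mult_nonpos_nonneg)
  ultimately show "\<exists>D. ((\<lambda>r. w r t - r\<^sup>2 / 2) has_real_derivative D) (at r) \<and> D \<le> 0" by blast
next
  have "continuous_on {-b..b} (\<lambda>r. w r t)"
    by (rule DERIV_continuous_on) (use w_u assms in auto)
  then show "continuous_on {v..u} (\<lambda>r. w r t - r\<^sup>2 / 2)"
    by (intro continuous_intros) (rule continuous_on_subset, use assms in auto)
qed

text \<open>Determined by \<open>b\<close> and the initial slope at the origin, hence common to all
  \<open>\<epsilon>\<close> that share the initial datum.\<close>

definition slope_bound :: real where "slope_bound = b\<^sup>2 / 2 + w 0 0"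

lemma slope_bound_pos: "0 < slope_bound"
  using init_w[of 0] b_pos by (auto simp: slope_bound_def intro!: add_nonneg_pos)

text \<open>On \<open>[0,b]\<close> the function \<open>w - u\<^sup>2 / 2\<close> lies between its
  values at \<open>b\<close> and at \<open>0\<close>, which \<open>w_b_nonneg\<close> and
  \<open>w_0_antimono\<close> control.\<close>

lemma w_bound:
  assumes "u \<in> {0..b}" "0 \<le> t"
  shows "\<bar>w u t\<bar> \<le> slope_bound"
proof -
  have "w u t - u\<^sup>2 / 2 \<le> w 0 t" "w b t - b\<^sup>2 / 2 \<le> w u t - u\<^sup>2 / 2"
    using w_minus_square_antimono[of 0 u t] w_minus_square_antimono[of u b t] assms by auto
  moreover have w00: "0 < w 0 0" using init_w[of 0] b_pos by simp
  moreover have "w 0 t \<le> w 0 0" using w_0_antimono[of 0 t] assms by auto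
  moreover have "u\<^sup>2 \<le> b\<^sup>2" "0 \<le> u\<^sup>2" using assms by (auto intro!: power_mono)
  ultimately show ?thesis
    using w_b_nonneg[OF assms(2)] w00 unfolding slope_bound_def abs_le_iff
    by (intro conjI; linarith)
qed

text \<open>This is \<open>q \<ge> u - M * (w\<^sup>2 + \<epsilon>)\<close> in integrated form, by
  the mean value theorem. It mentions slopes only, so it survives convergence of first
  derivatives.\<close>

lemma w_slope:
  assumes "0 \<le> v" "v < u" "u \<le> b" "0 \<le> t" and S: "\<And>r. r \<in> {v..u} \<Longrightarrow> (w r t)\<^sup>2 \<le> S"
  shows "(u - v) * (v - M * (S + \<epsilon>)) \<le> w u t - w v t"
proof -
  have "continuous_on {-b..b} (\<lambda>r. w r t)"
    by (rule DERIV_continuous_on) (use w_u assms in auto)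
  then have c: "continuous_on {v..u} (\<lambda>r. w r t)"
    by (rule continuous_on_subset) (use assms in auto)
  have d: "((\<lambda>r. w r t) has_real_derivative q r t) (at r)" if "v < r" "r < u" for r
    using w_u[of r t] at_interior[of r] that assms by auto
  obtain r where r: "v < r" "r < u" "w u t - w v t = (u - v) * q r t"
    using MVT[OF assms(2) c] d DERIV_unique by (metis real_differentiable_def)
  have "- M * (S + \<epsilon>) \<le> - M * ((w r t)\<^sup>2 + \<epsilon>)"
    using S[of r] r M_nonneg by (intro mult_left_mono_neg) auto
  also have "\<dots> \<le> z r t * ((w r t)\<^sup>2 + \<epsilon>)"
    using z_lower[of r t] r assms denom_pos[of r t] by (intro mult_right_mono) auto
  also have "\<dots> = q r t - r" using flow_closed[of r t] r assms by auto
  finally have "v - M * (S + \<epsilon>) \<le> q r t" using r by simp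
  then show ?thesis using r assms by (simp add: mult_left_mono)
qed

section \<open>Decay of the slope at the origin\<close>

lemma y_bound:
  assumes "u \<in> {0..b}" "0 \<le> t"
  shows "\<bar>y u t\<bar> \<le> b * slope_bound"
proof -
  have "norm (y u t - y 0 t) \<le> slope_bound * norm (u - 0)"
  proof (rule field_differentiable_bound[of "{0..b}"])
    show "((\<lambda>v. y v t) has_real_derivative w v t) (at v within {0..b})" if "v \<in> {0..b}" for v
      using y_u[of v t] that assms b_pos by (auto intro: DERIV_subset)
  qed (use assms w_bound b_pos in auto)
  also have "\<dots> \<le> slope_bound * b" using assms slope_bound_pos by (intro mult_left_mono) auto
  finally show ?thesis using y_0 assms by (simp add: mult.commute)
qed

lemma continuous_slice:
  fixes f :: "real \<Rightarrow> real \<Rightarrow> real"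
  assumes "continuous_on ({-b..b} \<times> {0..}) (\<lambda>(u, t). f u t)" "0 \<le> t"
  shows "continuous_on {0..b} (\<lambda>u. f u t)"
proof -
  have "continuous_on {0..b} ((\<lambda>(u, t). f u t) \<circ> (\<lambda>u. (u, t)))"
    by (rule continuous_on_compose) (auto intro!: continuous_intros continuous_on_subset[OF assms(1)] simp: assms(2))
  then show ?thesis by (simp add: o_def)
qed

text \<open>Testing the equation with \<open>u - b\<close>, which vanishes at \<open>b\<close> only, isolates \<open>w 0 t\<close>.\<close>

lemma w_0_le_integral:
  assumes "0 \<le> t"
  shows "b * w 0 t \<le> 1 - b ^ 3 / 6 - b * (slope_bound\<^sup>2 + \<epsilon>) * integral {0..b} (\<lambda>u. z u t)"
proof -
  \<comment> \<open>Integration by parts: \<open>w - u\<^sup>2 / 2\<close> is a primitive of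
    \<open>q - u\<close>, and \<open>y - u ^ 3 / 6\<close> is a primitive of
    \<open>w - u\<^sup>2 / 2\<close>.\<close>
  let ?G = "\<lambda>u. (w u t - u\<^sup>2 / 2) * (u - b) - y u t + u ^ 3 / 6"
  have "((\<lambda>u. (q u t - u) * (u - b)) has_integral ?G b - ?G 0) {0..b}"
  proof (rule fundamental_theorem_of_calculus)
    fix u assume u: "u \<in> {0..b}"
    have 1: "((\<lambda>v. y v t) has_real_derivative w u t) (at u within {0..b})"
      and 2: "((\<lambda>v. w v t) has_real_derivative q u t) (at u within {0..b})"
      using y_u[of u t] w_u[of u t] u assms b_pos by (auto intro: DERIV_subset)
    have "(?G has_real_derivative (q u t - u) * (u - b)) (at u within {0..b})"
      by (auto intro!: derivative_eq_intros 1 2 simp: field_simps power2_eq_square)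
    then show "(?G has_vector_derivative (q u t - u) * (u - b)) (at u within {0..b})"
      by (simp add: has_real_derivative_iff_has_vector_derivative)
  qed (use b_pos in auto)
  moreover have "?G b - ?G 0 = b * w 0 t - 1 + b ^ 3 / 6"
    using bdry y_0 assms by simp
  ultimately have I: "((\<lambda>u. (q u t - u) * (u - b)) has_integral b * w 0 t - 1 + b ^ 3 / 6) {0..b}"
    by metis
  have "(\<lambda>u. z u t) integrable_on {0..b}"
    by (intro integrable_continuous_real continuous_slice cont_z assms)
  then have J: "((\<lambda>u. - (b * (slope_bound\<^sup>2 + \<epsilon>)) * z u t) has_integral
      - (b * (slope_bound\<^sup>2 + \<epsilon>)) * integral {0..b} (\<lambda>u. z u t)) {0..b}"
    by (intro has_integral_mult_right integrable_integral)
  \<comment> \<open>The integrand is \<open>- z \<ge> 0\<close> times the weight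
    \<open>(b - u) * (w\<^sup>2 + \<epsilon>)\<close>. Bounding the weight by a constant leaves the
    plain integral of \<open>z\<close>, which is a time derivative.\<close>
  have "b * w 0 t - 1 + b ^ 3 / 6 \<le> - (b * (slope_bound\<^sup>2 + \<epsilon>)) * integral {0..b} (\<lambda>u. z u t)"
  proof (rule has_integral_le[OF I J])
    fix u assume u: "u \<in> {0..b}"
    have "(w u t)\<^sup>2 \<le> slope_bound\<^sup>2"
      using w_bound[OF u assms] by (metis abs_ge_zero power2_abs power_mono)
    then have "(b - u) * ((w u t)\<^sup>2 + \<epsilon>) \<le> b * (slope_bound\<^sup>2 + \<epsilon>)"
      using u eps_pos by (intro mult_mono) auto
    then have "(- z u t) * ((b - u) * ((w u t)\<^sup>2 + \<epsilon>)) \<le> (- z u t) * (b * (slope_bound\<^sup>2 + \<epsilon>))"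
      using z_nonpos[OF u assms] by (intro mult_left_mono) auto
    moreover have "q u t - u = z u t * ((w u t)\<^sup>2 + \<epsilon>)"
      using flow_closed[of u t] u assms b_pos by auto
    then have "(q u t - u) * (u - b) = (- z u t) * ((b - u) * ((w u t)\<^sup>2 + \<epsilon>))"
      by (simp only:) (simp add: algebra_simps)
    ultimately show "(q u t - u) * (u - b) \<le> - (b * (slope_bound\<^sup>2 + \<epsilon>)) * z u t"
      by (simp add: algebra_simps)
  qed
  then show ?thesis by simp
qed

text \<open>The integral of \<open>z\<close> over \<open>[0,b]\<close> is the time derivative of the
  bounded quantity \<open>F\<close>. At some time \<open>t\<close> before \<open>T\<close> it equals
  its average, which is of order \<open>1 / T\<close>; \<open>w_0_antimono\<close> carries the
  resulting estimate from \<open>t\<close> to \<open>T\<close>.\<close>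

lemma w_0_decay:
  assumes "0 < T"
  shows "b * w 0 T \<le> 1 - b ^ 3 / 6 + 2 * b ^ 3 * slope_bound * (slope_bound\<^sup>2 + \<epsilon>) / T"
proof -
  define F where "F = (\<lambda>t. integral {0..b} (\<lambda>u. y u t))"
  have F': "(F has_real_derivative integral {0..b} (\<lambda>u. z u t)) (at t within {0..T})" if "t \<in> {0..T}" for t
    unfolding F_def
  proof (rule leibniz_rule_field_derivative[where f = "\<lambda>t u. y u t" and fx = "\<lambda>t u. z u t" and a = 0 and b = b, unfolded cbox_interval])
    show "((\<lambda>s. y u s) has_real_derivative z u s) (at s within {0..T})" if "s \<in> {0..T}" "u \<in> {0..b}" for s u
      using y_t[of u s] that b_pos by (auto intro: DERIV_subset)
    show "(\<lambda>u. y u s) integrable_on {0..b}" if "s \<in> {0..T}" for s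
      using that by (intro integrable_continuous_real continuous_slice cont_y) auto
    have "continuous_on ({0..T} \<times> {0..b}) ((\<lambda>(u, t). z u t) \<circ> prod.swap)"
    proof (rule continuous_on_compose)
      show "continuous_on (prod.swap ` ({0..T} \<times> {0..b})) (\<lambda>(u, t). z u t)"
        by (rule continuous_on_subset[OF cont_z]) (use b_pos in auto)
    qed (rule continuous_on_swap)
    then show "continuous_on ({0..T} \<times> {0..b}) (\<lambda>(t, u). z u t)"
      by (simp add: o_def case_prod_unfold)
  qed (use that in auto)
  have "\<exists>t\<in>{0<..<T}. F T - F 0 = (T - 0) * integral {0..b} (\<lambda>u. z u t)"
  proof -
    have "\<exists>t\<in>{0<..<T}. F T - F 0 = (\<lambda>h. h * integral {0..b} (\<lambda>u. z u t)) (T - 0)"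
      by (rule mvt_simple[OF assms])
        (use F' in \<open>auto simp: has_field_derivative_def mult.commute[of _ "integral _ _"]\<close>)
    then show ?thesis by simp
  qed
  then obtain t where t: "0 < t" "t < T" "F T - F 0 = T * integral {0..b} (\<lambda>u. z u t)" by auto
  have bd: "\<bar>F s\<bar> \<le> b * (b * slope_bound)" if "0 \<le> s" for s
  proof -
    have "norm (F s) \<le> (b * slope_bound) * (b - 0)" unfolding F_def
      by (rule integral_bound) (use b_pos continuous_slice[OF cont_y that] y_bound that in auto)
    then show ?thesis by (simp add: mult_ac)
  qed
  have "F 0 - F T \<le> 2 * b\<^sup>2 * slope_bound"
    using bd[of 0] bd[of T] assms by (auto simp: power2_eq_square abs_le_iff)
  then have "- integral {0..b} (\<lambda>u. z u t) \<le> 2 * b\<^sup>2 * slope_bound / T"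
    using t assms by (simp add: field_simps)
  then have "(b * (slope_bound\<^sup>2 + \<epsilon>)) * (- integral {0..b} (\<lambda>u. z u t)) \<le> (b * (slope_bound\<^sup>2 + \<epsilon>)) * (2 * b\<^sup>2 * slope_bound / T)"
    using b_pos eps_pos by (intro mult_left_mono) auto
  moreover have "b * w 0 T \<le> b * w 0 t" using w_0_antimono[of t T] t b_pos by simp
  ultimately show ?thesis
    using w_0_le_integral[of t] t by (simp add: power2_eq_square power3_eq_cube algebra_simps)
qed

end

section \<open>From classical solutions to the locale\<close>

lemma DERIV_within_cong:
  fixes f g :: "real \<Rightarrow> real"
  assumes "(f has_real_derivative D) (at a within S)" "a \<in> S" "\<And>v. v \<in> S \<Longrightarrow> f v = g v"
  shows "(g has_real_derivative D) (at a within S)"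
  by (rule has_field_derivative_transform_within[OF assms(1), of 1]) (use assms in auto)

text \<open>\<open>D\<close> collects the partials continuous down to \<open>t = 0\<close>,
  \<open>E\<close> the higher ones for \<open>t > 0\<close>. Uniqueness of derivatives identifies
  them where both exist, so \<open>E\<close> supplies the derivatives of
  \<open>z = D 0 1\<close>.\<close>

lemma regularized_solution_flow:
  assumes b: "0 < b" and eps: "0 < \<epsilon>" and M: "0 \<le> M"
    and sol: "regularized_solution b x0 \<epsilon> y"
    and bd: "x0 (-b) = -1" "x0 b = 1"
    and pos: "\<forall>u\<in>{-b..b}. 0 < ider b x0 u"
    and odd: "\<forall>u\<in>{-b<..<b}. x0 u = - x0 (-u)"
    and conc: "\<forall>u\<in>{0<..<b}. ider b (ider b x0) u \<le> u"
    and bdM: "\<forall>u\<in>{0..b}. - M * (ider b x0 u)\<^sup>2 \<le> ider b (ider b x0) u - u"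
  obtains w q z zu zuu zt where "regularized_flow b \<epsilon> M y w q z zu zuu zt"
    and "\<And>u t. u \<in> {-b..b} \<Longrightarrow> 0 \<le> t \<Longrightarrow> w u t = pd_u b y u t"
    and "w 0 0 = ider b x0 0"
proof -
  obtain D where D0: "\<forall>u\<in>{-b..b}. \<forall>t\<in>{0..}. D 0 0 u t = y u t"
    and D: "partials_on (\<lambda>i j. i + 2 * j \<le> 2 * 1) {-b..b} {0..} D"
    using sol unfolding regularized_solution_def parabolic_C_def by blast
  obtain E where E0: "\<forall>u\<in>{-b..b}. \<forall>t\<in>{0<..}. E 0 0 u t = y u t"
    and E: "partials_on (\<lambda>i j. i + 2 * j \<le> 2 * 2) {-b..b} {0<..} E"
    using sol unfolding regularized_solution_def parabolic_C_def by blast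
  have Dc: "continuous_on ({-b..b} \<times> {0..}) (\<lambda>(u, t). D i j u t)" if "i + 2 * j \<le> 2" for i j
    using D that unfolding partials_on_def by auto
  have Du: "((\<lambda>v. D i j v t) has_real_derivative D (Suc i) j u t) (at u within {-b..b})"
    if "Suc i + 2 * j \<le> 2" "u \<in> {-b..b}" "0 \<le> t" for i j u t
    using D that unfolding partials_on_def by auto
  have Dt: "((\<lambda>s. D i j u s) has_real_derivative D i (Suc j) u t) (at t within {0..})"
    if "i + 2 * Suc j \<le> 2" "u \<in> {-b..b}" "0 \<le> t" for i j u t
    using D that unfolding partials_on_def by auto
  have Eu: "((\<lambda>v. E i j v t) has_real_derivative E (Suc i) j u t) (at u within {-b..b})"
    if "Suc i + 2 * j \<le> 4" "u \<in> {-b..b}" "0 < t" for i j u t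
    using E that unfolding partials_on_def by auto
  have Et: "((\<lambda>s. E i j u s) has_real_derivative E i (Suc j) u t) (at t)"
    if "i + 2 * Suc j \<le> 4" "u \<in> {-b..b}" "0 < t" for i j u t
  proof -
    have "((\<lambda>s. E i j u s) has_real_derivative E i (Suc j) u t) (at t within {0<..})"
      using E that unfolding partials_on_def by auto
    then show ?thesis using that by (simp add: at_within_open[of t "{0<..}"])
  qed
  have y_u: "((\<lambda>v. y v t) has_real_derivative D 1 0 u t) (at u within {-b..b})"
    if "u \<in> {-b..b}" "0 \<le> t" for u t
    unfolding One_nat_def by (rule DERIV_within_cong[OF Du[of 0 0]]) (use D0 that in auto)
  have w_u: "((\<lambda>v. D 1 0 v t) has_real_derivative D 2 0 u t) (at u within {-b..b})"
    if "u \<in> {-b..b}" "0 \<le> t" for u t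
    using Du[of 1 0 u t] that by (simp add: numeral_2_eq_2)
  have y_t: "((\<lambda>s. y u s) has_real_derivative D 0 1 u t) (at t within {0..})"
    if "u \<in> {-b..b}" "0 \<le> t" for u t
    unfolding One_nat_def by (rule DERIV_within_cong[OF Dt[of 0 0]]) (use D0 that in auto)
  have pd: "pd_u b y u t = D 1 0 u t" if "u \<in> {-b..b}" "0 \<le> t" for u t
    unfolding pd_u_def by (rule ider_eq[OF b that(1) y_u[OF that]])
  have pd2: "pd_u b (pd_u b y) u t = D 2 0 u t" if "u \<in> {-b..b}" "0 \<le> t" for u t
    unfolding pd_u_def[of b "pd_u b y"]
    by (rule ider_eq[OF b that(1)], rule DERIV_within_cong[OF w_u[OF that]]) (use that pd in auto)
  have E10: "E 1 0 u t = D 1 0 u t" if "u \<in> {-b..b}" "0 < t" for u t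
  proof -
    have "((\<lambda>v. y v t) has_real_derivative E 1 0 u t) (at u within {-b..b})"
      unfolding One_nat_def by (rule DERIV_within_cong[OF Eu[of 0 0]]) (use E0 that in auto)
    then show ?thesis
      using ider_eq[OF b that(1)] y_u[OF that(1) less_imp_le[OF that(2)]] by metis
  qed
  have E20: "E 2 0 u t = D 2 0 u t" if "u \<in> {-b..b}" "0 < t" for u t
  proof -
    have "((\<lambda>v. E 1 0 v t) has_real_derivative E 2 0 u t) (at u within {-b..b})"
      using Eu[of 1 0 u t] that by (simp add: numeral_2_eq_2)
    then have "((\<lambda>v. D 1 0 v t) has_real_derivative E 2 0 u t) (at u within {-b..b})"
      by (rule DERIV_within_cong) (use that E10 in auto)
    then show ?thesis
      using ider_eq[OF b that(1)] w_u[OF that(1) less_imp_le[OF that(2)]] by metis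
  qed
  have E01: "E 0 1 u t = D 0 1 u t" if "u \<in> {-b..b}" "0 < t" for u t
  proof (rule DERIV_unique)
    show "(y u has_real_derivative E 0 1 u t) (at t)"
      by (rule has_field_derivative_transform_within_open[of "E 0 0 u" _ _ "{0<..}"])
        (use Et[of 0 0 u t] E0 that in auto)
    have "at t within {0..} = at t" by (rule at_within_interior) (use that in simp)
    then show "(y u has_real_derivative D 0 1 u t) (at t)"
      using y_t[of u t] that by simp
  qed
  have transf: "((\<lambda>s. D i j u s) has_real_derivative E i (Suc j) u t) (at t)"
    if "i + 2 * Suc j \<le> 4" "u \<in> {-b..b}" "0 < t" "\<And>s. 0 < s \<Longrightarrow> E i j u s = D i j u s" for i j u t
    by (rule has_field_derivative_transform_within_open[of "E i j u" _ _ "{0<..}"])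
      (use Et[of i j u t] that in auto)
  have init: "y u 0 = x0 u" if "u \<in> {-b..b}" for u
    using sol that unfolding regularized_solution_def by auto
  have w0: "ider b x0 u = D 1 0 u 0" if "u \<in> {-b..b}" for u
    by (rule ider_eq[OF b that], rule DERIV_within_cong[OF y_u]) (use that init in auto)
  have q0: "ider b (ider b x0) u = D 2 0 u 0" if "u \<in> {-b..b}" for u
    by (rule ider_eq[OF b that], rule DERIV_within_cong[OF w_u]) (use that w0 in auto)
  have "regularized_flow b \<epsilon> M y (D 1 0) (D 2 0) (D 0 1) (E 1 1) (E 2 1) (E 0 2)"
  proof
    show "((\<lambda>v. D 0 1 v t) has_real_derivative E 1 1 u t) (at u within {-b..b})"
      if "u \<in> {-b..b}" "0 < t" for u t
      by (rule DERIV_within_cong[OF Eu[of 0 1, folded One_nat_def]]) (use E01 that in auto)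
    show "((\<lambda>v. E 1 1 v t) has_real_derivative E 2 1 u t) (at u within {-b..b})"
      if "u \<in> {-b..b}" "0 < t" for u t
      using Eu[of 1 1 u t] that by (simp add: numeral_2_eq_2)
    \<comment> \<open>Symmetry of mixed partials is built into \<open>partials_on\<close>:
      \<open>E 1 1\<close> is the \<open>t\<close>-derivative of \<open>E 1 0\<close> as well as the
      \<open>u\<close>-derivative of \<open>E 0 1\<close>, and likewise for
      \<open>E 2 1\<close>.\<close>
    show "(D 1 0 u has_real_derivative E 1 1 u t) (at t)"
      "(D 2 0 u has_real_derivative E 2 1 u t) (at t)"
      "(D 0 1 u has_real_derivative E 0 2 u t) (at t)"
      if "u \<in> {-b..b}" "0 < t" for u t
      using transf[of 1 0 u t] transf[of 2 0 u t] transf[of 0 1 u t] E10[OF that(1)] E20[OF that(1)]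
        E01[OF that(1)] that by (simp_all add: numeral_2_eq_2)
    show "continuous_on ({-b..b} \<times> {0..}) (\<lambda>(u, t). y u t)"
      using Dc[of 0 0] by (rule continuous_on_eq) (use D0 in auto)
    show "D 0 1 u t * ((D 1 0 u t)\<^sup>2 + \<epsilon>) = D 2 0 u t - u" if "u \<in> {-b<..<b}" "0 < t" for u t
    proof -
      have "pd_t y u t = (pd_u b (pd_u b y) u t - u) / ((pd_u b y u t)\<^sup>2 + \<epsilon>)"
        using sol that unfolding regularized_solution_def by blast
      moreover have "pd_t y u t = D 0 1 u t"
        by (rule pd_t_eq) (use that y_t in auto)
      moreover have "0 < (D 1 0 u t)\<^sup>2 + \<epsilon>" using eps by (simp add: add_nonneg_pos)
      ultimately show ?thesis using pd[of u t] pd2[of u t] that by (simp add: eq_divide_eq)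
    qed
    \<comment> \<open>The boundary condition is imposed for \<open>t > 0\<close>; at
      \<open>t = 0\<close> the values come from \<open>x0\<close>.\<close>
    show "y b t = 1" "y (-b) t = -1" if "0 \<le> t" for t
      using sol that init[of b] init[of "-b"] bd b unfolding regularized_solution_def
      by (cases "t = 0"; auto)+
    show "y (-u) 0 = - y u 0" if "u \<in> {-b..b}" for u
    proof (cases "u = b \<or> u = -b")
      case True
      then show ?thesis using init bd that by auto
    next
      case False
      then have "u \<in> {-b<..<b}" using that by auto
      then have "x0 u = - x0 (-u)" by (rule odd[rule_format])
      then show ?thesis using init[of u] init[of "-u"] that by simp
    qed
    show "continuous_on ({-b..b} \<times> {0..}) (\<lambda>(u, t). D 1 0 u t)"
      "continuous_on ({-b..b} \<times> {0..}) (\<lambda>(u, t). D 2 0 u t)"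
      "continuous_on ({-b..b} \<times> {0..}) (\<lambda>(u, t). D 0 1 u t)"
      by (rule Dc; simp)+
    show "0 < D 1 0 u 0" if "u \<in> {-b..b}" for u
      using bspec[OF pos that] w0[OF that] by simp
    show "D 2 0 u 0 \<le> u" if "u \<in> {0<..<b}" for u
      using bspec[OF conc that] q0[of u] that by auto
    show "- M * (D 1 0 u 0)\<^sup>2 \<le> D 2 0 u 0 - u" if "u \<in> {0..b}" for u
      using bspec[OF bdM that] w0[of u] q0[of u] that by auto
  qed (fact b eps M y_u w_u y_t)+
  then show thesis by (rule that) (use pd w0[of 0] b in auto)
qed

section \<open>Passage to the limit\<close>

lemma holder_cont_continuous:
  assumes "0 < \<alpha>" "holder_cont S \<alpha> f"
  shows "continuous_on S f"
  unfolding continuous_on_def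
proof
  fix u assume u: "u \<in> S"
  obtain C where C: "\<forall>u\<in>S. \<forall>v\<in>S. \<bar>f u - f v\<bar> \<le> C * \<bar>u - v\<bar> powr \<alpha>"
    using assms(2) unfolding holder_cont_def by blast
  have "continuous_on S (\<lambda>v. C * \<bar>v - u\<bar> powr \<alpha>)"
    using assms(1) by (intro continuous_intros continuous_on_powr') auto
  then have lim: "((\<lambda>v. C * \<bar>v - u\<bar> powr \<alpha>) \<longlongrightarrow> 0) (at u within S)"
    using u by (force simp: continuous_on_def)
  have "((\<lambda>v. f v - f u) \<longlongrightarrow> 0) (at u within S)"
    by (rule Lim_null_comparison[OF _ lim]) (use C u in \<open>auto simp: eventually_at_filter\<close>)
  then show "(f \<longlongrightarrow> f u) (at u within S)"
    by (simp add: LIM_zero_iff)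
qed

lemma holder_space_1_iff:
  "f \<in> holder_space b 1 \<alpha> \<longleftrightarrow> f differentiable_on {-b..b} \<and> holder_cont {-b..b} \<alpha> (ider b f)"
  by (auto simp: holder_space_def)

lemma ider_derivative:
  assumes "0 < b" "f differentiable_on {-b..b}" "u \<in> {-b..b}"
  shows "(f has_real_derivative ider b f u) (at u within {-b..b})"
proof -
  obtain D where "(f has_real_derivative D) (at u within {-b..b})"
    using assms(2,3) unfolding differentiable_on_def real_differentiable_def by blast
  then show ?thesis using ider_eq[OF assms(1,3)] by simp
qed

lemma holder_space_1_diff:
  assumes "0 < b" "f \<in> holder_space b 1 \<alpha>" "g \<in> holder_space b 1 \<alpha>"
  shows "(\<lambda>u. f u - g u) \<in> holder_space b 1 \<alpha>"
    and "u \<in> {-b..b} \<Longrightarrow> ider b (\<lambda>u. f u - g u) u = ider b f u - ider b g u"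
proof -
  show id: "ider b (\<lambda>u. f u - g u) u = ider b f u - ider b g u" if "u \<in> {-b..b}" for u
    by (rule ider_eq[OF assms(1) that])
      (use assms(1) assms(2,3)[unfolded holder_space_1_iff] that in \<open>auto intro!: DERIV_diff ider_derivative\<close>)
  obtain C1 C2 where C:
    "\<forall>u\<in>{-b..b}. \<forall>v\<in>{-b..b}. \<bar>ider b f u - ider b f v\<bar> \<le> C1 * \<bar>u - v\<bar> powr \<alpha>"
    "\<forall>u\<in>{-b..b}. \<forall>v\<in>{-b..b}. \<bar>ider b g u - ider b g v\<bar> \<le> C2 * \<bar>u - v\<bar> powr \<alpha>"
    using assms(2,3) unfolding holder_space_1_iff holder_cont_def by blast
  have "\<forall>u\<in>{-b..b}. \<forall>v\<in>{-b..b}. \<bar>ider b (\<lambda>u. f u - g u) u - ider b (\<lambda>u. f u - g u) v\<bar>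
      \<le> (C1 + C2) * \<bar>u - v\<bar> powr \<alpha>"
  proof (intro ballI)
    fix u v assume uv: "u \<in> {-b..b}" "v \<in> {-b..b}"
    have "\<bar>ider b f u - ider b f v\<bar> \<le> C1 * \<bar>u - v\<bar> powr \<alpha>"
      "\<bar>ider b g u - ider b g v\<bar> \<le> C2 * \<bar>u - v\<bar> powr \<alpha>" using C uv by auto
    then show "\<bar>ider b (\<lambda>u. f u - g u) u - ider b (\<lambda>u. f u - g u) v\<bar> \<le> (C1 + C2) * \<bar>u - v\<bar> powr \<alpha>"
      unfolding id[OF uv(1)] id[OF uv(2)] distrib_right by linarith
  qed
  then show "(\<lambda>u. f u - g u) \<in> holder_space b 1 \<alpha>"
    using assms(2,3) unfolding holder_space_1_iff holder_cont_def
    by (auto intro!: differentiable_on_diff)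
qed

lemma holder_norm_1_bounds:
  assumes "0 < b" "0 < \<alpha>" "f \<in> holder_space b 1 \<alpha>" "u \<in> {-b..b}"
  shows "\<bar>f u\<bar> \<le> holder_norm b 1 \<alpha> f" "\<bar>ider b f u\<bar> \<le> holder_norm b 1 \<alpha> f"
proof -
  have sup: "\<bar>g u\<bar> \<le> (SUP u\<in>{-b..b}. \<bar>g u\<bar>)" if "continuous_on {-b..b} g" "u \<in> {-b..b}" for g :: "real \<Rightarrow> real" and u
  proof (rule cSUP_upper[OF that(2)])
    have "compact ((\<lambda>u. \<bar>g u\<bar>) ` {-b..b})"
      by (intro compact_continuous_image continuous_intros that) auto
    then show "bdd_above ((\<lambda>u. \<bar>g u\<bar>) ` {-b..b})"
      by (simp add: bounded_imp_bdd_above compact_imp_bounded)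
  qed
  have f: "f differentiable_on {-b..b}" "holder_cont {-b..b} \<alpha> (ider b f)"
    using assms(3) unfolding holder_space_1_iff by auto
  note s1 = sup[OF differentiable_imp_continuous_on[OF f(1)] assms(4)]
  note s2 = sup[OF holder_cont_continuous[OF assms(2) f(2)] assms(4)]
  obtain C where C: "\<forall>u\<in>{-b..b}. \<forall>v\<in>{-b..b}. \<bar>ider b f u - ider b f v\<bar> \<le> C * \<bar>u - v\<bar> powr \<alpha>"
    using f(2) unfolding holder_cont_def by blast
  let ?P = "{(u, v). u \<in> {-b..b} \<and> v \<in> {-b..b} \<and> u \<noteq> v}"
  let ?h = "\<lambda>(u, v). \<bar>ider b f u - ider b f v\<bar> / \<bar>u - v\<bar> powr \<alpha>"
  \<comment> \<open>\<open>SUP\<close> over an unbounded or empty set of reals carries no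
    information. The Hoelder constant bounds the quotients and the pair \<open>(-b, b)\<close>
    provides one, so the seminorm is nonnegative.\<close>
  have "?h p \<le> C" if "p \<in> ?P" for p
    using C that by (auto simp: divide_le_eq)
  then have bdd: "bdd_above (?h ` ?P)" by (intro bdd_aboveI2[where M = C]) auto
  have "0 \<le> ?h (-b, b)" by simp
  also have "\<dots> \<le> (SUP p\<in>?P. ?h p)"
    by (rule cSUP_upper[OF _ bdd]) (use assms(1) in auto)
  finally have s3: "0 \<le> (SUP p\<in>?P. ?h p)" .
  have "holder_norm b 1 \<alpha> f = (SUP u\<in>{-b..b}. \<bar>f u\<bar>) + (SUP u\<in>{-b..b}. \<bar>ider b f u\<bar>) + (SUP p\<in>?P. ?h p)"
    by (simp add: holder_norm_def)
  then show "\<bar>f u\<bar> \<le> holder_norm b 1 \<alpha> f" "\<bar>ider b f u\<bar> \<le> holder_norm b 1 \<alpha> f"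
    using s1 s2 s3 by auto
qed

text \<open>The norm of a time increment dominates the increment of the slope. At
  \<open>u = 0\<close> this makes the set of times with nonpositive slope closed.\<close>

lemma C0_holder_continuous_pd_u:
  assumes "0 < b" "0 < \<alpha>" "f \<in> C0_holder b 1 \<alpha>" "u \<in> {-b..b}"
  shows "continuous_on {0..} (pd_u b f u)"
  unfolding continuous_on_def
proof
  fix t :: real assume t: "t \<in> {0..}"
  have H: "(\<lambda>u. f u s) \<in> holder_space b 1 \<alpha>" if "0 \<le> s" for s
    using assms(3) that by (auto simp: C0_holder_def)
  have lim: "((\<lambda>s. holder_norm b 1 \<alpha> (\<lambda>u. f u s - f u t)) \<longlongrightarrow> 0) (at t within {0..})"
    using assms(3) t by (auto simp: C0_holder_def)
  have "((\<lambda>s. pd_u b f u s - pd_u b f u t) \<longlongrightarrow> 0) (at t within {0..})"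
  proof (rule Lim_null_comparison[OF _ lim])
    have "norm (pd_u b f u s - pd_u b f u t) \<le> holder_norm b 1 \<alpha> (\<lambda>u. f u s - f u t)" if "0 \<le> s" for s
      using holder_norm_1_bounds(2)[OF assms(1,2) holder_space_1_diff(1)[OF assms(1) H[OF that] H[of t]] assms(4)]
        holder_space_1_diff(2)[OF assms(1) H[OF that] H[of t] assms(4)] t
      by (simp add: pd_u_def)
    then show "\<forall>\<^sub>F s in at t within {0..}. norm (pd_u b f u s - pd_u b f u t)
        \<le> holder_norm b 1 \<alpha> (\<lambda>u. f u s - f u t)"
      by (auto simp: eventually_at_filter)
  qed
  then show "(pd_u b f u \<longlongrightarrow> pd_u b f u t) (at t within {0..})"
    by (simp add: LIM_zero_iff)
qed

lemma C0loc_holder_conv_uniform: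
  assumes "0 < b" "0 < \<alpha>" "C0loc_holder_conv b 1 \<alpha> X f" "0 \<le> t" "0 < e"
  shows "\<forall>\<^sub>F n in sequentially. \<forall>u\<in>{-b..b}.
    \<bar>X n u t - f u t\<bar> < e \<and> \<bar>pd_u b (X n) u t - pd_u b f u t\<bar> < e"
proof -
  have H: "(\<lambda>u. X n u t) \<in> holder_space b 1 \<alpha>" "(\<lambda>u. f u t) \<in> holder_space b 1 \<alpha>" for n
    using assms(3,4) by (auto simp: C0loc_holder_conv_def C0_holder_def)
  \<comment> \<open>The horizon \<open>t + 1\<close> is positive also for \<open>t = 0\<close>, as
    the definition of local convergence requires.\<close>
  have "uniform_limit {0..t + 1} (\<lambda>n t. holder_norm b 1 \<alpha> (\<lambda>u. X n u t - f u t)) (\<lambda>t. 0) sequentially"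
    using assms(3,4) by (auto simp: C0loc_holder_conv_def)
  then have "\<forall>\<^sub>F n in sequentially. \<forall>s\<in>{0..t + 1}. dist (holder_norm b 1 \<alpha> (\<lambda>u. X n u s - f u s)) 0 < e"
    using assms(5) by (rule uniform_limitD)
  then show ?thesis
  proof eventually_elim
    case (elim n)
    then have "\<bar>holder_norm b 1 \<alpha> (\<lambda>u. X n u t - f u t)\<bar> < e" using assms(4) by simp
    then have small: "holder_norm b 1 \<alpha> (\<lambda>u. X n u t - f u t) < e" by linarith
    show ?case
    proof
      fix u assume u: "u \<in> {-b..b}"
      note bd = holder_norm_1_bounds[OF assms(1,2) holder_space_1_diff(1)[OF assms(1) H(1)[of n] H(2)] u]
      show "\<bar>X n u t - f u t\<bar> < e \<and> \<bar>pd_u b (X n) u t - pd_u b f u t\<bar> < e"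
        unfolding pd_u_def using bd[unfolded holder_space_1_diff(2)[OF assms(1) H u]] small by linarith
    qed
  qed
qed

section \<open>Invertibility and sign of the slope of a single profile\<close>

lemma DERIV_neg_at_0_neg_value:
  fixes f :: "real \<Rightarrow> real"
  assumes "0 < b" "(f has_real_derivative D) (at 0 within {-b..b})" "D < 0" "f 0 = 0"
  shows "\<exists>h\<in>{0<..<b}. f h < 0"
proof -
  obtain d where d: "0 < d" "\<And>h. 0 < h \<Longrightarrow> h \<in> {-b..b} \<Longrightarrow> h < d \<Longrightarrow> f h < f 0"
    using has_real_derivative_neg_dec_right[OF assms(2,3)] by auto
  show ?thesis
    by (rule bexI[of _ "min d b / 2"]) (use d(2)[of "min d b / 2"] d(1) assms(1,4) in \<open>auto simp: min_def\<close>)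
qed

text \<open>With a negative slope at the origin, \<open>f\<close> turns negative just to the right
  and takes the value 0 again on its way up to \<open>f b = 1\<close>. With slope zero, the chain
  rule for the inverse composed with \<open>f\<close> would give 0 = 1.\<close>

lemma no_differentiable_inverse:
  fixes f :: "real \<Rightarrow> real"
  assumes b: "0 < b" and cont: "continuous_on {-b..b} f"
    and D: "(f has_real_derivative D) (at 0 within {-b..b})" "D \<le> 0"
    and f: "f 0 = 0" "f b = 1"
  shows "\<not> has_differentiable_inverse_on {-b..b} f"
proof
  assume "has_differentiable_inverse_on {-b..b} f"
  then have inj: "inj_on f {-b..b}" and diff: "inv_into {-b..b} f differentiable_on f ` {-b..b}"
    by (auto simp: has_differentiable_inverse_on_def)
  have "D = 0"
  proof (rule ccontr)
    assume "D \<noteq> 0"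
    then obtain h where h: "0 < h" "h < b" "f h < 0"
      using DERIV_neg_at_0_neg_value[OF b D(1)] D(2) f(1) by auto
    have "\<exists>v\<ge>h. v \<le> b \<and> f v = 0"
      by (rule IVT') (use h f cont b in \<open>auto intro: continuous_on_subset\<close>)
    then show False using inj_onD[OF inj, of _ 0] h f by force
  qed
  have "0 \<in> f ` {-b..b}" using f(1) b by (force intro!: image_eqI[of _ _ 0])
  then obtain E where E: "(inv_into {-b..b} f has_real_derivative E) (at (f 0) within f ` {-b..b})"
    using diff f(1) by (auto simp: differentiable_on_def real_differentiable_def)
  have "(inv_into {-b..b} f \<circ> f has_real_derivative E * D) (at 0 within {-b..b})"
    by (rule DERIV_image_chain[OF E D(1)])
  then have "((\<lambda>v. v) has_real_derivative E * D) (at 0 within {-b..b})"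
    by (rule DERIV_within_cong) (use b inj in auto)
  moreover have "((\<lambda>v. v) has_real_derivative 1) (at 0 within {-b..b})" by simp
  ultimately have "E * D = 1"
    by (rule DERIV_within_unique[of _ _ _ _ _ b]) (use b in auto)
  with \<open>D = 0\<close> show False by simp
qed

text \<open>The slope condition says \<open>w' \<ge> u - M w\<^sup>2\<close>; at a zero \<open>u > 0\<close> it forces \<open>w\<close> to be negative to
  the left of \<open>u\<close>, so the leftmost point with \<open>w \<le> 0\<close> is the origin.\<close>

lemma nonpos_propagates_to_0:
  fixes w :: "real \<Rightarrow> real"
  assumes cont: "continuous_on {0..b} w" and M: "0 \<le> M"
    and slope: "\<And>v u S. 0 \<le> v \<Longrightarrow> v < u \<Longrightarrow> u \<le> b \<Longrightarrow> 0 < S \<Longrightarrow> (\<And>r. r \<in> {v..u} \<Longrightarrow> \<bar>w r\<bar> < S) \<Longrightarrow>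
      (u - v) * (v - M * S\<^sup>2) \<le> w u - w v"
    and u0: "u0 \<in> {0..b}" "w u0 \<le> 0"
  shows "w 0 \<le> 0"
proof (rule ccontr)
  assume w0: "\<not> w 0 \<le> 0"
  define A where "A = {u \<in> {0..b}. w u \<le> 0}"
  have "A = {0..b} \<inter> w -` {..0}" by (auto simp: A_def)
  then have "closed A"
    using continuous_closed_preimage[OF cont, of "{..0}"] by simp
  moreover have bddA: "bdd_below A" unfolding A_def by (rule bdd_belowI[of _ 0]) auto
  moreover have "A \<noteq> {}" using u0 by (auto simp: A_def)
  ultimately have "Inf A \<in> A" using closed_contains_Inf by blast
  define u where "u = Inf A"
  have u: "0 \<le> u" "u \<le> b" "w u \<le> 0" using \<open>Inf A \<in> A\<close> by (auto simp: A_def u_def)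
  have min: "0 < w v" if "0 \<le> v" "v < u" for v
  proof -
    have "v \<notin> A" using cInf_lower[OF _ bddA, of v] that by (auto simp: u_def)
    then show ?thesis using that u by (auto simp: A_def)
  qed
  have "u \<noteq> 0" using u w0 by auto
  then have u_pos: "0 < u" using u by simp
  \<comment> \<open>Some zero lies in \<open>[0,u]\<close>; as \<open>w\<close> is positive before
    \<open>u\<close>, it is \<open>u\<close> itself.\<close>
  have "\<exists>v\<ge>0. v \<le> u \<and> w v = 0"
    by (rule IVT2') (use u w0 cont in \<open>auto intro: continuous_on_subset\<close>)
  then have wu: "w u = 0" using min by force
  \<comment> \<open>The quadratic term must lose against the linear one:
    \<open>M * e\<^sup>2 \<le> u / 4\<close> stays below every \<open>v \<ge> u / 2\<close>. The
    \<open>+ 1\<close> covers \<open>M = 0\<close>.\<close>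
  define e where "e = sqrt (u / (4 * (M + 1)))"
  have e: "0 < e" "M * e\<^sup>2 \<le> u / 4" using u_pos M by (auto simp: e_def field_simps)
  obtain d where d: "0 < d" "\<And>v. v \<in> {0..b} \<Longrightarrow> \<bar>v - u\<bar> < d \<Longrightarrow> \<bar>w v\<bar> < e"
  proof -
    have "\<exists>d>0. \<forall>v\<in>{0..b}. dist v u < d \<longrightarrow> dist (w v) (w u) < e"
      using cont u e(1) unfolding continuous_on_iff by simp
    then show ?thesis using that wu by (auto simp: dist_real_def)
  qed
  define v where "v = max (u / 2) (u - d / 2)"
  have v: "0 \<le> v" "u / 2 \<le> v" "v < u" "u - v < d" using d(1) u_pos by (auto simp: v_def)
  have "(u - v) * (v - M * e\<^sup>2) \<le> w u - w v"
    by (rule slope) (use v u e d in auto)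
  moreover have "0 < (u - v) * (v - M * e\<^sup>2)" using v e u_pos by (intro mult_pos_pos) auto
  ultimately show False using min[of v] v wu by simp
qed

lemma ider_odd:
  assumes "0 < b" "f differentiable_on {-b..b}" "\<And>v. v \<in> {-b..b} \<Longrightarrow> f (-v) = - f v" "u \<in> {-b..b}"
  shows "ider b f (-u) = ider b f u"
proof -
  have "(f has_real_derivative ider b f (-u)) (at (-u) within uminus ` {-b..b})"
    using ider_derivative[OF assms(1,2), of "-u"] assms(4) by simp
  then have "(f \<circ> uminus has_real_derivative ider b f (-u) * -1) (at u within {-b..b})"
    by (rule DERIV_image_chain) (auto intro!: derivative_eq_intros)
  then have "((\<lambda>v. - (f \<circ> uminus) v) has_real_derivative - (ider b f (-u) * -1)) (at u within {-b..b})"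
    by (rule DERIV_minus)
  then have "(f has_real_derivative - (ider b f (-u) * -1)) (at u within {-b..b})"
    by (rule DERIV_within_cong) (use assms(3,4) in auto)
  then show ?thesis using ider_eq[OF assms(1,4)] by fastforce
qed

text \<open>The quotient of \<open>ider b (ider b x0) u - u\<close> by the squared slope is the
  right-hand side of the unregularized equation at time 0. Positivity of the slope makes it
  continuous on a compact interval, hence bounded.\<close>

lemma initial_slope_bound:
  assumes "0 < b" "0 < \<beta>" "x0 \<in> holder_space b 2 \<beta>" "\<forall>u\<in>{-b..b}. ider b x0 u > 0"
  obtains M where "0 \<le> M" "\<forall>u\<in>{0..b}. - M * (ider b x0 u)\<^sup>2 \<le> ider b (ider b x0) u - u"
proof -
  have 1: "ider b x0 differentiable_on {-b..b}" and 2: "holder_cont {-b..b} \<beta> (ider b (ider b x0))"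
    using assms(3) by (auto simp: holder_space_def numeral_2_eq_2 less_Suc_eq)
  have "continuous_on {-b..b} (\<lambda>u. (ider b (ider b x0) u - u) / (ider b x0 u)\<^sup>2)"
    using assms(4) by (intro continuous_intros differentiable_imp_continuous_on[OF 1]
        holder_cont_continuous[OF assms(2) 2]) force
  then have "bounded ((\<lambda>u. (ider b (ider b x0) u - u) / (ider b x0 u)\<^sup>2) ` {-b..b})"
    by (intro compact_imp_bounded compact_continuous_image) auto
  then obtain M where "0 < M" and M: "\<forall>u\<in>{-b..b}. \<bar>(ider b (ider b x0) u - u) / (ider b x0 u)\<^sup>2\<bar> \<le> M"
    unfolding bounded_pos by auto
  show thesis
  proof (rule that[of M])
    show "\<forall>u\<in>{0..b}. - M * (ider b x0 u)\<^sup>2 \<le> ider b (ider b x0) u - u"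
    proof
      fix u assume "u \<in> {0..b}"
      then have u: "u \<in> {-b..b}" using assms(1) by auto
      have "0 < (ider b x0 u)\<^sup>2" using bspec[OF assms(4) u] by simp
      moreover have "- M \<le> (ider b (ider b x0) u - u) / (ider b x0 u)\<^sup>2"
        using bspec[OF M u] by linarith
      ultimately show "- M * (ider b x0 u)\<^sup>2 \<le> ider b (ider b x0) u - u"
        by (simp only: pos_le_divide_eq)
    qed
  qed (use \<open>0 < M\<close> in simp)
qed

section \<open>The limit solution and its critical time\<close>

theorem theorem1p4:
  fixes b \<beta> :: real and x0 :: "real \<Rightarrow> real" and x :: "real \<Rightarrow> real \<Rightarrow> real"
  assumes "b > root 3 6"
    and "0 < \<beta>" "\<beta> < 1"
    and "x0 \<in> holder_space b 2 \<beta>"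
    and "x0 (-b) = -1" "x0 b = 1"
    and "ider b (ider b x0) (-b) = -b" "ider b (ider b x0) b = b"
    and "\<forall>u\<in>{-b..b}. ider b x0 u > 0"
    and "\<forall>u\<in>{-b<..<b}. x0 u = - x0 (-u)"
    and "\<forall>u\<in>{0<..<b}. ider b (ider b x0) u \<le> u"
    and "constructed_solution b x0 x"
  shows "(\<exists>t0>0.
            (\<forall>u\<in>{-b..b}. \<forall>t\<in>{0<..<t0}. pd_u b x u t > 0) \<and>
            (\<forall>t\<ge>t0. \<not> has_differentiable_inverse_on {-b..b} (\<lambda>u. x u t))) \<and>
         (\<exists>T. \<forall>t\<ge>T. \<exists>y\<in>(\<lambda>u. x u t) ` {0..b}. y < 0)"
proof -
  have "0 < root 3 (6::real)" by simp
  with assms(1) have b: "0 < b" by linarith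
  have "(root 3 6) ^ 3 < b ^ 3"
    using assms(1) by (intro power_strict_mono) auto
  then have b3: "6 < b ^ 3" by simp
  obtain M where M: "0 \<le> M" "\<forall>u\<in>{0..b}. - M * (ider b x0 u)\<^sup>2 \<le> ider b (ider b x0) u - u"
    using initial_slope_bound[OF b assms(2,4,9)] by blast
  obtain eps X where eps: "\<forall>k. 0 < eps k" "eps \<longlonglongrightarrow> (0::real)"
    and sol: "\<forall>k. regularized_solution b x0 (eps k) (X k)"
    and conv: "\<forall>\<alpha>\<in>{0<..<1}. C0loc_holder_conv b 1 \<alpha> X x"
    using assms(12) unfolding constructed_solution_def by blast
  define W where "W = b\<^sup>2 / 2 + ider b x0 0"
  have W: "0 < W" using assms(9) b by (auto simp: W_def intro!: add_nonneg_pos)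
  \<comment> \<open>The estimates are restated through \<open>pd_u\<close>, with constants
    \<open>M\<close> and \<open>W\<close> independent of \<open>k\<close>, so that the limit can be
    taken outside the locale.\<close>
  have flow: "(\<forall>u\<in>{-b..b}. \<forall>t\<ge>0. X k (-u) t = - X k u t) \<and> (\<forall>t\<ge>0. X k b t = 1) \<and>
      (\<forall>s\<ge>0. \<forall>t\<ge>s. pd_u b (X k) 0 t \<le> pd_u b (X k) 0 s) \<and>
      (\<forall>v\<ge>0. \<forall>u>v. \<forall>t\<ge>0. \<forall>S. u \<le> b \<longrightarrow> (\<forall>r\<in>{v..u}. (pd_u b (X k) r t)\<^sup>2 \<le> S) \<longrightarrow>
        (u - v) * (v - M * (S + eps k)) \<le> pd_u b (X k) u t - pd_u b (X k) v t) \<and>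
      (\<forall>T>0. b * pd_u b (X k) 0 T \<le> 1 - b ^ 3 / 6 + 2 * b ^ 3 * W * (W\<^sup>2 + eps k) / T)" for k
  proof -
    obtain w q z zu zuu zt where flow: "regularized_flow b (eps k) M (X k) w q z zu zuu zt"
      and w: "\<And>u t. u \<in> {-b..b} \<Longrightarrow> 0 \<le> t \<Longrightarrow> w u t = pd_u b (X k) u t"
      and w0: "w 0 0 = ider b x0 0"
      using regularized_solution_flow[OF b eps(1)[rule_format] M(1) sol[rule_format] assms(5,6,9,10,11) M(2)]
      by blast
    interpret regularized_flow b "eps k" M "X k" w q z zu zuu zt by (rule flow)
    have Weq: "slope_bound = W" by (simp add: slope_bound_def W_def w0)
    have w_00: "w 0 t = pd_u b (X k) 0 t" if "0 \<le> t" for t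
      using w[of 0 t] b that by simp
    show ?thesis
    proof (intro conjI ballI allI impI)
      fix v u t S :: real assume *: "0 \<le> v" "v < u" "0 \<le> t" "u \<le> b"
        and S: "\<forall>r\<in>{v..u}. (pd_u b (X k) r t)\<^sup>2 \<le> S"
      have "(w r t)\<^sup>2 \<le> S" if "r \<in> {v..u}" for r
        using bspec[OF S that] w[of r t] that * by auto
      from w_slope[OF *(1,2,4,3) this]
      show "(u - v) * (v - M * (S + eps k)) \<le> pd_u b (X k) u t - pd_u b (X k) v t"
        using w[of u t] w[of v t] * by auto
    next
      show "b * pd_u b (X k) 0 T \<le> 1 - b ^ 3 / 6 + 2 * b ^ 3 * W * (W\<^sup>2 + eps k) / T" if "0 < T" for T
        using w_0_decay[OF that] w_00[of T] that by (simp add: Weq)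
      show "pd_u b (X k) 0 t \<le> pd_u b (X k) 0 s" if "0 \<le> s" "s \<le> t" for s t
        using w_0_antimono[OF that] w_00 that by simp
    qed (use y_odd bdry in auto)
  qed
  have C: "C0loc_holder_conv b 1 (1/2) X x" using conv by simp
  then have xC: "x \<in> C0_holder b 1 (1/2)" by (simp add: C0loc_holder_conv_def)
  have unif: "\<forall>\<^sub>F n in sequentially. \<forall>u\<in>{-b..b}.
      \<bar>X n u t - x u t\<bar> < e \<and> \<bar>pd_u b (X n) u t - pd_u b x u t\<bar> < e" if "0 \<le> t" "0 < e" for t e
    by (rule C0loc_holder_conv_uniform[OF b _ C that]) simp
  have lim: "(\<lambda>n. X n u t) \<longlonglongrightarrow> x u t" "(\<lambda>n. pd_u b (X n) u t) \<longlonglongrightarrow> pd_u b x u t"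
    if "u \<in> {-b..b}" "0 \<le> t" for u t
    unfolding tendsto_iff dist_real_def
    using that by (auto intro!: eventually_mono[OF unif[OF that(2)]])
  have x_diff: "(\<lambda>u. x u t) differentiable_on {-b..b}"
    and xu_cont: "continuous_on {-b..b} (\<lambda>u. pd_u b x u t)" if "0 \<le> t" for t
  proof -
    have "(\<lambda>u. x u t) \<in> holder_space b 1 (1/2)"
      using xC that unfolding C0_holder_def by blast
    then have *: "(\<lambda>u. x u t) differentiable_on {-b..b}"
        "holder_cont {-b..b} (1/2) (ider b (\<lambda>u. x u t))"
      unfolding holder_space_1_iff by auto
    show "(\<lambda>u. x u t) differentiable_on {-b..b}" by fact
    show "continuous_on {-b..b} (\<lambda>u. pd_u b x u t)"
      unfolding pd_u_def by (rule holder_cont_continuous[OF _ *(2)]) simp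
  qed
  have x_deriv: "((\<lambda>v. x v t) has_real_derivative pd_u b x u t) (at u within {-b..b})"
    if "u \<in> {-b..b}" "0 \<le> t" for u t
    unfolding pd_u_def by (rule ider_derivative[OF b x_diff[OF that(2)] that(1)])
  have x_odd: "x (-u) t = - x u t" if "u \<in> {-b..b}" "0 \<le> t" for u t
  proof (rule LIMSEQ_unique)
    show "(\<lambda>n. X n (-u) t) \<longlonglongrightarrow> x (-u) t" using lim(1)[of "-u" t] that by auto
    show "(\<lambda>n. X n (-u) t) \<longlonglongrightarrow> - x u t"
      using tendsto_minus[OF lim(1)[OF that]] flow that by simp
  qed
  have x_0: "x 0 t = 0" if "0 \<le> t" for t using x_odd[of 0 t] b that by simp
  have x_b: "x b t = 1" if "0 \<le> t" for t
    using lim(1)[of b t] flow b that LIMSEQ_unique[OF _ tendsto_const] by simp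
  have xu_0_init: "0 < pd_u b x 0 0"
  proof -
    have "x u 0 = x0 u" if "u \<in> {-b..b}" for u
    proof (rule LIMSEQ_unique[OF lim(1)[OF that]])
      show "(\<lambda>n. X n u 0) \<longlonglongrightarrow> x0 u"
        using sol that unfolding regularized_solution_def by simp
    qed simp
    then have "(x0 has_real_derivative pd_u b x 0 0) (at 0 within {-b..b})"
      using DERIV_within_cong[OF x_deriv[of 0 0], of x0] b by simp
    then have "ider b x0 0 = pd_u b x 0 0" using ider_eq[OF b] b by simp
    then show ?thesis using bspec[OF assms(9), of 0] b by simp
  qed
  have xu_0_antimono: "pd_u b x 0 t \<le> pd_u b x 0 s" if "0 \<le> s" "s \<le> t" for s t
    by (rule LIMSEQ_le[OF lim(2)[of 0 t] lim(2)[of 0 s]]) (use flow that b in auto)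
  have xu_slope: "(u - v) * (v - M * S\<^sup>2) \<le> pd_u b x u t - pd_u b x v t"
    if "0 \<le> v" "v < u" "u \<le> b" "0 < S" and S: "\<And>r. r \<in> {v..u} \<Longrightarrow> \<bar>pd_u b x r t\<bar> < S" and t: "0 \<le> t"
    for v u S t
  proof -
    \<comment> \<open>The strict bound \<open>S\<close> on the limit slope passes to the
      approximations up to a margin \<open>e\<close>, uniformly on \<open>[v,u]\<close>. Letting
      first \<open>n\<close> tend to infinity and then \<open>e\<close> to 0 removes both
      \<open>eps n\<close> and the margin.\<close>
    have *: "(u - v) * (v - M * (S + e)\<^sup>2) \<le> pd_u b x u t - pd_u b x v t" if "0 < e" for e
    proof (rule LIMSEQ_le)
      show "(\<lambda>n. (u - v) * (v - M * ((S + e)\<^sup>2 + eps n))) \<longlonglongrightarrow> (u - v) * (v - M * (S + e)\<^sup>2)"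
        by (rule tendsto_eq_intros eps(2) refl)+ simp
      show "(\<lambda>n. pd_u b (X n) u t - pd_u b (X n) v t) \<longlonglongrightarrow> pd_u b x u t - pd_u b x v t"
        using \<open>0 \<le> v\<close> \<open>v < u\<close> \<open>u \<le> b\<close> t by (intro tendsto_diff lim) auto
      have "\<forall>\<^sub>F n in sequentially. (u - v) * (v - M * ((S + e)\<^sup>2 + eps n)) \<le> pd_u b (X n) u t - pd_u b (X n) v t"
        using unif[OF t that]
      proof eventually_elim
        case (elim n)
        have "(pd_u b (X n) r t)\<^sup>2 \<le> (S + e)\<^sup>2" if "r \<in> {v..u}" for r
        proof -
          have "\<bar>pd_u b (X n) r t - pd_u b x r t\<bar> < e"
            using elim that \<open>0 \<le> v\<close> \<open>u \<le> b\<close> by auto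
          then have "\<bar>pd_u b (X n) r t\<bar> \<le> S + e" using S[OF that] by linarith
          then show ?thesis by (metis abs_ge_zero power2_abs power_mono)
        qed
        then show ?case using flow[of n] \<open>0 \<le> v\<close> \<open>v < u\<close> \<open>u \<le> b\<close> t by simp
      qed
      then show "\<exists>N. \<forall>n\<ge>N. (u - v) * (v - M * ((S + e)\<^sup>2 + eps n)) \<le> pd_u b (X n) u t - pd_u b (X n) v t"
        by (simp add: eventually_sequentially)
    qed
    have "((\<lambda>e. (u - v) * (v - M * (S + e)\<^sup>2)) \<longlongrightarrow> (u - v) * (v - M * (S + 0)\<^sup>2)) (at_right 0)"
      by (intro tendsto_intros)
    moreover have "\<forall>\<^sub>F e in at_right 0. (u - v) * (v - M * (S + e)\<^sup>2) \<le> pd_u b x u t - pd_u b x v t"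
      using * by (auto simp: eventually_at_filter)
    ultimately have "(u - v) * (v - M * (S + 0)\<^sup>2) \<le> pd_u b x u t - pd_u b x v t"
      by (rule tendsto_upperbound) simp
    then show ?thesis by simp
  qed
  have xu_decay: "b * pd_u b x 0 T \<le> 1 - b ^ 3 / 6 + 2 * b ^ 3 * W ^ 3 / T" if "0 < T" for T
  proof (rule LIMSEQ_le)
    show "(\<lambda>n. b * pd_u b (X n) 0 T) \<longlonglongrightarrow> b * pd_u b x 0 T"
      using b that by (intro tendsto_intros lim) auto
    have "(\<lambda>n. 1 - b ^ 3 / 6 + 2 * b ^ 3 * W * (W\<^sup>2 + eps n) / T) \<longlonglongrightarrow>
        1 - b ^ 3 / 6 + 2 * b ^ 3 * W * (W\<^sup>2 + 0) / T"
      using that by (intro tendsto_intros eps(2)) simp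
    then show "(\<lambda>n. 1 - b ^ 3 / 6 + 2 * b ^ 3 * W * (W\<^sup>2 + eps n) / T) \<longlonglongrightarrow>
        1 - b ^ 3 / 6 + 2 * b ^ 3 * W ^ 3 / T"
      by (simp add: power2_eq_square power3_eq_cube mult.assoc)
  qed (use flow that in auto)
  define \<kappa> where "\<kappa> = b ^ 3 / 6 - 1"
  have \<kappa>: "0 < \<kappa>" using b3 by (simp add: \<kappa>_def)
  \<comment> \<open>The gap \<open>\<kappa>\<close> is positive because \<open>b ^ 3 > 6\<close>,
    and this \<open>T\<close> pushes the decay term \<open>2 * b ^ 3 * W ^ 3 / T\<close> below
    it.\<close>
  define T where "T = 2 * b ^ 3 * W ^ 3 / \<kappa> + 1"
  have T: "0 < T" using W b \<kappa> by (auto simp: T_def intro!: add_nonneg_pos)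
  have neg: "pd_u b x 0 t < 0" if "T \<le> t" for t
  proof -
    have "2 * b ^ 3 * W ^ 3 < \<kappa> * T" using \<kappa> by (simp add: T_def distrib_left)
    then have "2 * b ^ 3 * W ^ 3 / T < \<kappa>" using T by (simp add: pos_divide_less_eq)
    then have "b * pd_u b x 0 T < 0" using xu_decay[OF T] by (simp add: \<kappa>_def)
    then have "pd_u b x 0 T < 0" using b by (simp add: mult_less_0_iff)
    then show ?thesis using xu_0_antimono[of T t] T that by linarith
  qed
  \<comment> \<open>The critical time \<open>t0\<close> is the first one with nonpositive slope at
    the origin: the infimum is attained because \<open>A\<close> is closed, and it is positive
    because the initial slope is.\<close>
  define A where "A = {t \<in> {0..}. pd_u b x 0 t \<le> 0}"
  define t0 where "t0 = Inf A"
  have "continuous_on {0..} (pd_u b x 0)"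
    by (rule C0_holder_continuous_pd_u[OF b _ xC]) (use b in auto)
  then have "closed ({0..} \<inter> pd_u b x 0 -` {..0})"
    by (rule continuous_closed_preimage) auto
  moreover have "{0..} \<inter> pd_u b x 0 -` {..0} = A" by (auto simp: A_def)
  moreover have "T \<in> A" using T neg[of T] by (simp add: A_def)
  moreover have bddA: "bdd_below A" unfolding A_def by (rule bdd_belowI[of _ 0]) auto
  ultimately have "t0 \<in> A" unfolding t0_def using closed_contains_Inf[of A] by auto
  then have t0: "0 \<le> t0" "pd_u b x 0 t0 \<le> 0" by (auto simp: A_def)
  with xu_0_init have t0_pos: "0 < t0" by (cases "t0 = 0") auto
  have pos: "0 < pd_u b x u t" if u: "u \<in> {-b..b}" and t: "t \<in> {0<..<t0}" for u t
  proof -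
    have "t \<notin> A" using cInf_lower[OF _ bddA, of t] t by (auto simp: t0_def)
    then have xu0: "0 < pd_u b x 0 t" using t by (auto simp: A_def)
    \<comment> \<open>A nonpositive slope anywhere on \<open>[0,b]\<close> would spread to the
      origin, where the slope is still positive before \<open>t0\<close>. Oddness then covers the
      left half.\<close>
    have right: "0 < pd_u b x v t" if "v \<in> {0..b}" for v
    proof (rule ccontr)
      assume "\<not> 0 < pd_u b x v t"
      moreover have "continuous_on {0..b} (\<lambda>u. pd_u b x u t)"
        by (rule continuous_on_subset[OF xu_cont]) (use t in auto)
      ultimately have "pd_u b x 0 t \<le> 0"
        using nonpos_propagates_to_0[of b "\<lambda>u. pd_u b x u t" M v] M(1) xu_slope t that by simp
      with xu0 show False by simp
    qed
    show ?thesis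
    proof (cases "0 \<le> u")
      case True
      then show ?thesis using right u by simp
    next
      case False
      have "pd_u b x (-u) t = pd_u b x u t"
        unfolding pd_u_def by (rule ider_odd[OF b x_diff]) (use x_odd t u in auto)
      then show ?thesis using right[of "-u"] u False by simp
    qed
  qed
  have noinv: "\<not> has_differentiable_inverse_on {-b..b} (\<lambda>u. x u t)" if "t0 \<le> t" for t
  proof (rule no_differentiable_inverse[OF b])
    have t: "0 \<le> t" using t0_pos that by simp
    show "continuous_on {-b..b} (\<lambda>u. x u t)"
      by (rule differentiable_imp_continuous_on[OF x_diff[OF t]])
    show "((\<lambda>u. x u t) has_real_derivative pd_u b x 0 t) (at 0 within {-b..b})"
      using x_deriv[of 0 t] b t by simp
    show "pd_u b x 0 t \<le> 0" using xu_0_antimono[OF t0(1) that] t0(2) by linarith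
    show "x 0 t = 0" "x b t = 1" using x_0 x_b t by auto
  qed
  have "\<exists>y\<in>(\<lambda>u. x u t) ` {0..b}. y < 0" if "T \<le> t" for t
  proof -
    have t: "0 \<le> t" using T that by simp
    have "((\<lambda>u. x u t) has_real_derivative pd_u b x 0 t) (at 0 within {-b..b})"
      using x_deriv[of 0 t] b t by simp
    from DERIV_neg_at_0_neg_value[OF b this neg[OF that] x_0[OF t]]
    show ?thesis by force
  qed
  with pos noinv t0_pos show ?thesis by blast
qed

end
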